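(* Let $\mathfrak g$ be a complex simple Lie algebra with its standard Lie bialgebra structure, $\mathfrak l\subset\mathfrak g$ a Levi subalgebra, let $\mathbf t\in(\mathbb C^\times)^{\bar I}$ with $\chi_\theta(\mathbf t)\ne1$ for all $\theta\in\Delta_+(\mathfrak g;\mathfrak l)$, let $\chi\in\mathfrak z^*$ be a regular character of $\mathfrak l$ with $e^{-(\chi,\bar\alpha_s)}=t_s$ for all $s\in\bar I$, and put $\chi_{L^*}=e^\chi$. Then the Poisson brackets $\{-,-\}_{\chi_{L^*}}$ and $\{-,-\}_{\rho_{\mathbf t}}$ on $\mathbb C[[G/L]]$ coincide.
   Context: $\mathfrak h\subset\mathfrak l$ is a Cartan subalgebra of $\mathfrak g$, $\mathfrak z$ the center of $\mathfrak l$, $\alpha_s$ ($s\in[1,r]$) simple roots of $\mathfrak g$, $I$ the set of indices of simple roots of $\mathfrak l$, $\bar I=[1,r]\setminus I$, $\Delta_+(\mathfrak l)\subset\Delta_+(\mathfrak g)$ the positive roots. For $\alpha\in\Delta_+(\mathfrak g)\setminus\Delta_+(\mathfrak l)$, $\bar\alpha=\alpha_{|\mathfrak z}$; $\Delta_+(\mathfrak g;\mathfrak l)$ is the set of all such $\bar\alpha$. Each $\theta\in\Delta_+(\mathfrak g;\mathfrak l)$ is $\sum_{s\in\bar I}n_s(\theta)\bar\alpha_s$ with $n_s(\theta)\in\mathbb Z_{\ge0}$; $\chi_\theta(\mathbf t)=\prod_st_s^{n_s(\theta)}$. Characters of $\mathfrak l$ form $\mathfrak z^*\subset\mathfrak h^*$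 (extension by zero on $\mathfrak h\cap[\mathfrak l,\mathfrak l]$); $\chi$ is regular if $(\chi,\theta)\notin2\pi i\mathbb Z$ for all $\theta\in\Delta_+(\mathfrak g;\mathfrak l)$, where $(\chi,\bar\alpha):=(\chi,\alpha)$. $e_\alpha\in\mathfrak g_\alpha,f_\alpha\in\mathfrak g_{-\alpha}$, $\langle e_\alpha,f_\alpha\rangle=1$ (Killing form), $x\wedge y=x\otimes y-y\otimes x$. $r_0=\frac12\sum_{\alpha\in\Delta_+(\mathfrak g)}e_\alpha\wedge f_\alpha$, $\delta(a)=[a\otimes1+1\otimes a,r_0]$. $\mathbb C[[G]]=U(\mathfrak g)^*$ is the function algebra of the formal group $G$, $(\mathbf L_af)(x)=\frac{d}{d\epsilon}|_0f(e^{-\epsilon a}x)$, $(\mathbf R_af)(x)=\frac{d}{d\epsilon}|_0f(xe^{\epsilon a})$, $m$ the product. The Poisson-Lie bracket of $G$ is $\{g_1,g_2\}_G=m((\mathbf R^{\otimes2}-\mathbf L^{\otimes2})(r_0)(g_1\otimes g_2))$. $\mathbb C[[G/L]]=\{f\in\mathbb C[[G]]\mid\mathbf R_af=0\ \forall a\in\mathfrak l\}$. $\rho_{\mathbf t}=\frac12\sum_{\theta\in\Delta_+(\mathfrak g;\mathfrak l)}\frac{1+\chi_\theta(\mathbf t)}{1-\chi_\theta(\mathbf t)}\sum_{\alpha\in\Delta_+(\mathfrak g)\setminus\Delta_+(\mathfrak l),\,\bar\alpha=\theta}e_\alpha\wedge f_\alpha$, and on $\mathbb C[[G/L]]$, $\{f,g\}_{\rho_{\mathbf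 t}}=-m\big((\mathbf L^{\otimes2}(r_0)+\mathbf R^{\otimes2}(\rho_{\mathbf t}))(f\otimes g)\big)$. $L^*_{\mathrm{alg}}$ is the algebraic Poisson-Lie group with Lie bialgebra $\mathfrak l^*$, containing a torus $H^*_{\mathrm{alg}}$ with Lie algebra $\mathfrak h^*$; $e^\chi\in H^*_{\mathrm{alg}}$ for $\chi\in\mathfrak h^*$. The Poisson-Lie dynamical $r$-matrix $\sigma_{\mathfrak l}^{\mathfrak g}:L^*_{\mathrm{alg}}\to\wedge^2(\mathfrak g)$ takes on this torus the values $\sigma_{\mathfrak l}^{\mathfrak g}(e^\chi)=\sum_{\alpha\in\Delta_+(\mathfrak g)\setminus\Delta_+(\mathfrak l)}\frac{e_\alpha\wedge f_\alpha}{1-e^{-(\chi,\alpha)}}$ (when the denominators are nonzero). The reduced bracket at $\chi_{L^*}$ is the restriction to $\mathbb C[[G/L]]$ of $\{g_1,g_2\}_{\chi_{L^*}}=\{g_1,g_2\}_G-m\big(\mathbf R^{\otimes2}(\sigma_{\mathfrak l}^{\mathfrak g}(\chi_{L^*}))(g_1\otimes g_2)\big)$. *)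

theory Defs
  imports "HOL-Analysis.Analysis" "HOL-Library.Poly_Mapping"
begin

section \<open>Complex vector spaces and algebras\<close>

class complex_vector = ab_group_add +
  fixes scaleC :: "complex \<Rightarrow> 'a \<Rightarrow> 'a" (infixr \<open>*\<^sub>C\<close> 75)
  assumes scaleC_add_right: "a *\<^sub>C (x + y) = a *\<^sub>C x + a *\<^sub>C y"
    and scaleC_add_left: "(a + b) *\<^sub>C x = a *\<^sub>C x + b *\<^sub>C x"
    and scaleC_scaleC: "a *\<^sub>C b *\<^sub>C x = (a * b) *\<^sub>C x"
    and scaleC_one: "1 *\<^sub>C x = x"

class complex_algebra_1 = complex_vector + ring_1 +
  assumes mult_scaleC_left: "(a *\<^sub>C x) * y = a *\<^sub>C (x * y)"
    and mult_scaleC_right: "x * (a *\<^sub>C y) = a *\<^sub>C (x * y)"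

global_interpretation complex_vector: vector_space "scaleC :: complex \<Rightarrow> 'a \<Rightarrow> 'a::complex_vector"
  by unfold_locales (simp_all add: scaleC_add_right scaleC_add_left scaleC_scaleC scaleC_one)

abbreviation cspan :: "'a::complex_vector set \<Rightarrow> 'a set"
  where "cspan \<equiv> complex_vector.span"

definition clinear :: "('a::complex_vector \<Rightarrow> 'b::complex_vector) \<Rightarrow> bool"
  where "clinear f \<longleftrightarrow> Vector_Spaces.linear scaleC scaleC f"

definition cbilinear :: "('a::complex_vector \<Rightarrow> 'b::complex_vector \<Rightarrow> 'c::complex_vector) \<Rightarrow> bool"
  where "cbilinear f \<longleftrightarrow> (\<forall>x. clinear (f x)) \<and> (\<forall>y. clinear (\<lambda>x. f x y))"

lemma clinear_iff: "clinear f \<longleftrightarrow> (\<forall>x y. f (x + y) = f x + f y) \<and> (\<forall>c x. f (c *\<^sub>C x) = c *\<^sub>C f x)"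
  unfolding clinear_def Vector_Spaces.linear_iff
  by (simp add: complex_vector.vector_space_axioms)

lemma clinear_add: "clinear f \<Longrightarrow> f (x + y) = f x + f y"
  and clinear_scale: "clinear f \<Longrightarrow> f (c *\<^sub>C x) = c *\<^sub>C f x"
  by (simp_all add: clinear_iff)

lemma clinear_0: "clinear f \<Longrightarrow> f 0 = 0"
  using clinear_scale[of f 0 0] by simp

lemma clinear_diff: "clinear f \<Longrightarrow> f (x - y) = f x - f y"
  using clinear_add[of f "x - y" y] by simp

lemma clinear_uminus: "clinear f \<Longrightarrow> f (- x) = - f x"
  using clinear_diff[of f 0 x] by (simp add: clinear_0)

lemma clinear_sum: "clinear f \<Longrightarrow> f (sum g A) = (\<Sum>i\<in>A. f (g i))"
  by (induction A rule: infinite_finite_induct) (simp_all add: clinear_0 clinear_add)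

lemma clinear_vanishes_on_span:
  assumes "clinear f" "\<And>x. x \<in> S \<Longrightarrow> f x = 0" "x \<in> cspan S"
  shows "f x = 0"
  using assms(3)
  by (induction rule: complex_vector.span_induct_alt)
     (simp_all add: assms clinear_0 clinear_add clinear_scale)

instantiation complex :: complex_algebra_1
begin
definition scaleC_complex :: "complex \<Rightarrow> complex \<Rightarrow> complex"
  where "scaleC_complex = (*)"
instance by standard (simp_all add: scaleC_complex_def algebra_simps)
end

instantiation poly_mapping :: (type, complex_vector) complex_vector
begin
definition scaleC_poly_mapping :: "complex \<Rightarrow> ('a \<Rightarrow>\<^sub>0 'b) \<Rightarrow> 'a \<Rightarrow>\<^sub>0 'b"
  where "scaleC_poly_mapping c p = Poly_Mapping.map (scaleC c) p"
lemma lookup_scaleC: "Poly_Mapping.lookup (c *\<^sub>C p) k = c *\<^sub>C Poly_Mapping.lookup p k" for p :: "'a \<Rightarrow>\<^sub>0 'b"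
  by (simp add: scaleC_poly_mapping_def map.rep_eq when_def)
instance
  by standard (rule poly_mapping_eqI,
    simp add: lookup_scaleC lookup_add scaleC_add_right scaleC_add_left scaleC_scaleC scaleC_one)+
end

text \<open>The linear extension of a map defined on the basis of a free vector space.\<close>

definition free_lift :: "('k \<Rightarrow> 'v::complex_vector) \<Rightarrow> ('k \<Rightarrow>\<^sub>0 complex) \<Rightarrow> 'v"
  where "free_lift b p = (\<Sum>k\<in>Poly_Mapping.keys p. Poly_Mapping.lookup p k *\<^sub>C b k)"

lemma free_lift_superset:
  assumes "finite A" "Poly_Mapping.keys p \<subseteq> A"
  shows "free_lift b p = (\<Sum>k\<in>A. Poly_Mapping.lookup p k *\<^sub>C b k)"
  unfolding free_lift_def
  by (rule sum.mono_neutral_left) (use assms in \<open>auto simp: in_keys_iff\<close>)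

lemma clinear_free_lift: "clinear (free_lift b)"
proof -
  have "free_lift b (p + q) = free_lift b p + free_lift b q" for p q
  proof -
    have "finite (Poly_Mapping.keys p \<union> Poly_Mapping.keys q)" "Poly_Mapping.keys (p + q) \<subseteq> Poly_Mapping.keys p \<union> Poly_Mapping.keys q"
      "Poly_Mapping.keys p \<subseteq> Poly_Mapping.keys p \<union> Poly_Mapping.keys q" "Poly_Mapping.keys q \<subseteq> Poly_Mapping.keys p \<union> Poly_Mapping.keys q"
      by (auto simp: in_keys_iff lookup_add)
    then show ?thesis
      by (simp add: free_lift_superset[of "Poly_Mapping.keys p \<union> Poly_Mapping.keys q"] lookup_add scaleC_add_left sum.distrib)
  qed
  moreover have "free_lift b (c *\<^sub>C p) = c *\<^sub>C free_lift b p" for c p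
  proof -
    have "Poly_Mapping.keys (c *\<^sub>C p) \<subseteq> Poly_Mapping.keys p"
      by (auto simp: in_keys_iff lookup_scaleC)
    then show ?thesis
      by (simp add: free_lift_superset[of "Poly_Mapping.keys p"] lookup_scaleC complex_vector.scale_sum_right
          scaleC_scaleC scaleC_complex_def)
  qed
  ultimately show ?thesis by (simp add: clinear_iff)
qed

lemma free_lift_single [simp]: "free_lift b (Poly_Mapping.single k c) = c *\<^sub>C b k"
  by (simp add: free_lift_superset[of "{k}"])

lemma scaleC_single [simp]: "c *\<^sub>C Poly_Mapping.single k d = Poly_Mapping.single k (c * d :: complex)"
  by (rule poly_mapping_eqI) (simp add: lookup_scaleC lookup_single when_def scaleC_complex_def)

lemma poly_mapping_decompose: "(p :: 'k \<Rightarrow>\<^sub>0 complex) = (\<Sum>k\<in>Poly_Mapping.keys p. Poly_Mapping.single k (Poly_Mapping.lookup p k))"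
proof (rule poly_mapping_eqI)
  fix i
  have "Poly_Mapping.lookup (\<Sum>k\<in>Poly_Mapping.keys p. Poly_Mapping.single k (Poly_Mapping.lookup p k)) i = (\<Sum>k\<in>Poly_Mapping.keys p. Poly_Mapping.lookup p k when k = i)"
    by (simp add: lookup_sum lookup_single)
  also have "\<dots> = (\<Sum>k\<in>Poly_Mapping.keys p. if k = i then Poly_Mapping.lookup p k else 0)"
    by (simp add: when_def)
  also have "\<dots> = Poly_Mapping.lookup p i"
    by (simp add: in_keys_iff)
  finally show "Poly_Mapping.lookup p i = Poly_Mapping.lookup (\<Sum>k\<in>Poly_Mapping.keys p. Poly_Mapping.single k (Poly_Mapping.lookup p k)) i" ..
qed

lemma clinear_free_eqI:
  assumes "clinear f" "clinear g" "\<And>k. f (Poly_Mapping.single k 1) = g (Poly_Mapping.single k 1)"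
  shows "f (p :: 'k \<Rightarrow>\<^sub>0 complex) = g p"
proof -
  have "f (Poly_Mapping.single k c) = g (Poly_Mapping.single k c)" for k c
    using assms(3)[of k] clinear_scale[OF assms(1), of c "Poly_Mapping.single k 1"]
      clinear_scale[OF assms(2), of c "Poly_Mapping.single k 1"] by simp
  then show ?thesis
    by (subst (1 2) poly_mapping_decompose) (simp add: clinear_sum assms(1,2))
qed

section \<open>Tensor products\<close>

definition tensor_relations :: "('a::complex_vector \<times> 'b::complex_vector \<Rightarrow>\<^sub>0 complex) set"
  where "tensor_relations =
    {Poly_Mapping.single (x + x', y) 1 - Poly_Mapping.single (x, y) 1 - Poly_Mapping.single (x', y) 1 | x x' y. True} \<union>
    {Poly_Mapping.single (x, y + y') 1 - Poly_Mapping.single (x, y) 1 - Poly_Mapping.single (x, y') 1 | x y y'. True} \<union>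
    {Poly_Mapping.single (c *\<^sub>C x, y) 1 - Poly_Mapping.single (x, y) c | c x y. True} \<union>
    {Poly_Mapping.single (x, c *\<^sub>C y) 1 - Poly_Mapping.single (x, y) c | c x y. True}"

lemma equivp_span: "equivp (\<lambda>p q. p - q \<in> cspan S)"
proof (rule equivpI)
  show "symp (\<lambda>p q. p - q \<in> cspan S)"
    by (rule sympI) (metis complex_vector.span_neg minus_diff_eq)
  show "transp (\<lambda>p q. p - q \<in> cspan S)"
    by (rule transpI) (metis complex_vector.span_add diff_add_cancel add_diff_eq)
qed (simp add: reflp_def complex_vector.span_zero)

quotient_type (overloaded) ('a, 'b) tensor = "('a::complex_vector \<times> 'b::complex_vector) \<Rightarrow>\<^sub>0 complex"
  / "\<lambda>p q. p - q \<in> cspan tensor_relations"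
  by (rule equivp_span)

lemma span_diff_add: "p - q \<in> cspan S \<Longrightarrow> p' - q' \<in> cspan S \<Longrightarrow> (p + p') - (q + q') \<in> cspan S"
  by (metis add_diff_add complex_vector.span_add)

lemma span_diff_diff: "p - q \<in> cspan S \<Longrightarrow> p' - q' \<in> cspan S \<Longrightarrow> (p - p') - (q - q') \<in> cspan S"
  using complex_vector.span_diff[of "p - q" S "p' - q'"] by (simp add: algebra_simps)

lemma span_diff_uminus: "p - q \<in> cspan S \<Longrightarrow> - p - - q \<in> cspan S"
  using complex_vector.span_neg[of "p - q" S] by simp

lemma span_diff_scale: "p - q \<in> cspan S \<Longrightarrow> c *\<^sub>C p - c *\<^sub>C q \<in> cspan S"
  using complex_vector.span_scale[of "p - q" S c]
  by (simp add: complex_vector.scale_right_diff_distrib)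

instantiation tensor :: (complex_vector, complex_vector) complex_vector
begin
lift_definition zero_tensor :: "('a, 'b) tensor" is 0 .
lift_definition plus_tensor :: "('a, 'b) tensor \<Rightarrow> ('a, 'b) tensor \<Rightarrow> ('a, 'b) tensor" is "(+)"
  by (rule span_diff_add)
lift_definition minus_tensor :: "('a, 'b) tensor \<Rightarrow> ('a, 'b) tensor \<Rightarrow> ('a, 'b) tensor" is "(-)"
  by (rule span_diff_diff)
lift_definition uminus_tensor :: "('a, 'b) tensor \<Rightarrow> ('a, 'b) tensor" is uminus
  by (rule span_diff_uminus)
lift_definition scaleC_tensor :: "complex \<Rightarrow> ('a, 'b) tensor \<Rightarrow> ('a, 'b) tensor" is scaleC
  by (rule span_diff_scale)
instance
  by standard (transfer, simp add: algebra_simps scaleC_add_right scaleC_add_left scaleC_scaleC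
      scaleC_one complex_vector.span_zero)+
end

lift_definition tensor :: "'a::complex_vector \<Rightarrow> 'b::complex_vector \<Rightarrow> ('a, 'b) tensor"
    (infixl \<open>\<otimes>\<close> 72)
  is "\<lambda>x y. Poly_Mapping.single (x, y) 1" .

text \<open>The map induced by \<open>f\<close>; it is only meaningful for bilinear \<open>f\<close>.\<close>

definition tensor_lift ::
    "('a::complex_vector \<Rightarrow> 'b::complex_vector \<Rightarrow> 'c::complex_vector) \<Rightarrow> ('a, 'b) tensor \<Rightarrow> 'c"
  where "tensor_lift f t = free_lift (\<lambda>(x, y). f x y) (rep_tensor t)"

lemma tensor_add_left: "(x + x') \<otimes> y = x \<otimes> y + x' \<otimes> y"
  by transfer (subst diff_diff_eq[symmetric], rule complex_vector.span_base,
    unfold tensor_relations_def, blast)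

lemma tensor_add_right: "x \<otimes> (y + y') = x \<otimes> y + x \<otimes> y'"
  by transfer (subst diff_diff_eq[symmetric], rule complex_vector.span_base,
    unfold tensor_relations_def, blast)

lemma tensor_scale_left: "(c *\<^sub>C x) \<otimes> y = c *\<^sub>C (x \<otimes> y)"
  by transfer (unfold scaleC_single mult_1_right, rule complex_vector.span_base,
    unfold tensor_relations_def, blast)

lemma tensor_scale_right: "x \<otimes> (c *\<^sub>C y) = c *\<^sub>C (x \<otimes> y)"
  by transfer (unfold scaleC_single mult_1_right, rule complex_vector.span_base,
    unfold tensor_relations_def, blast)

lemma cbilinear_tensor: "cbilinear (\<otimes>)"
  by (simp add: cbilinear_def clinear_iff tensor_add_left tensor_add_right
      tensor_scale_left tensor_scale_right)

lemma free_lift_respects: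
  assumes "cbilinear f" "p - q \<in> cspan tensor_relations"
  shows "free_lift (\<lambda>(x, y). f x y) p = free_lift (\<lambda>(x, y). f x y) q"
proof -
  have "free_lift (\<lambda>(x, y). f x y) r = 0" if "r \<in> tensor_relations" for r
    using that assms(1) unfolding tensor_relations_def cbilinear_def clinear_iff
    by (auto simp: clinear_diff[OF clinear_free_lift] scaleC_one)
  from clinear_vanishes_on_span[OF clinear_free_lift this assms(2)] show ?thesis
    by (simp add: clinear_diff[OF clinear_free_lift])
qed

lemma tensor_lift_abs:
  assumes "cbilinear f"
  shows "tensor_lift f (abs_tensor p) = free_lift (\<lambda>(x, y). f x y) p"
proof -
  have "abs_tensor (rep_tensor (abs_tensor p)) = abs_tensor p"
    by (rule Quotient_abs_rep[OF Quotient_tensor])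
  then show ?thesis
    unfolding tensor_lift_def tensor.abs_eq_iff by (rule free_lift_respects[OF assms])
qed

lemma clinear_tensor_lift: "cbilinear f \<Longrightarrow> clinear (tensor_lift f)"
  unfolding clinear_iff
proof (intro conjI allI)
  fix s t :: "('a, 'b) tensor" and c
  assume f: "cbilinear f"
  obtain p q where [simp]: "s = abs_tensor p" "t = abs_tensor q"
    by (metis Quotient_abs_rep[OF Quotient_tensor])
  show "tensor_lift f (s + t) = tensor_lift f s + tensor_lift f t"
    by (simp add: plus_tensor.abs_eq tensor_lift_abs f clinear_add clinear_free_lift)
  show "tensor_lift f (c *\<^sub>C s) = c *\<^sub>C tensor_lift f s"
    by (simp add: scaleC_tensor.abs_eq tensor_lift_abs f clinear_scale clinear_free_lift)
qed

lemma tensor_lift_tensor [simp]: "cbilinear f \<Longrightarrow> tensor_lift f (x \<otimes> y) = f x y"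
  by (simp add: tensor.abs_eq tensor_lift_abs scaleC_one)

lemma tensor_eqI:
  assumes "clinear f" "clinear g" "\<And>x y. f (x \<otimes> y) = g (x \<otimes> y)"
  shows "f t = g t"
proof -
  have lin: "clinear (\<lambda>p. h (abs_tensor p))" if "clinear h" for h :: "('a, 'b) tensor \<Rightarrow> 'c"
    unfolding clinear_iff
    by (simp flip: plus_tensor.abs_eq scaleC_tensor.abs_eq add: clinear_add clinear_scale that)
  have "f (abs_tensor p) = g (abs_tensor p)" for p
    by (rule clinear_free_eqI[OF lin lin])
       (use assms in \<open>auto simp flip: tensor.abs_eq\<close>)
  then show ?thesis
    by (metis Quotient_abs_rep[OF Quotient_tensor])
qed

lemma clinear_plus: "clinear f \<Longrightarrow> clinear g \<Longrightarrow> clinear (\<lambda>x. f x + g x)"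
  by (simp add: clinear_iff scaleC_add_right)

lemma clinear_scaleC: "clinear f \<Longrightarrow> clinear (\<lambda>x. c *\<^sub>C f x)"
  by (simp add: clinear_iff scaleC_add_right scaleC_scaleC mult.commute)

lemma clinear_compose: "clinear f \<Longrightarrow> clinear g \<Longrightarrow> clinear (\<lambda>x. f (g x))"
  by (simp add: clinear_iff)

definition tensor_mult ::
    "('a::complex_algebra_1, 'b::complex_algebra_1) tensor \<Rightarrow> ('a, 'b) tensor \<Rightarrow> ('a, 'b) tensor"
  where "tensor_mult s t = tensor_lift (\<lambda>a b. tensor_lift (\<lambda>c d. (a * c) \<otimes> (b * d)) t) s"

lemma cbilinear_mult_inner: "cbilinear (\<lambda>c d. (a * c) \<otimes> (b * d))"
  for a :: "'a::complex_algebra_1" and b :: "'b::complex_algebra_1"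
  by (simp add: cbilinear_def clinear_iff distrib_left tensor_add_left tensor_add_right
      mult_scaleC_right tensor_scale_left tensor_scale_right)

lemma cbilinear_mult_outer: "cbilinear (\<lambda>a b. tensor_lift (\<lambda>c d. (a * c) \<otimes> (b * d)) t)"
  for t :: "('a::complex_algebra_1, 'b::complex_algebra_1) tensor"
  unfolding cbilinear_def clinear_iff
  by (intro conjI allI;
      rule tensor_eqI[of _ _ t];
      (intro clinear_plus clinear_scaleC clinear_tensor_lift cbilinear_mult_inner)?)
     (simp_all only: tensor_lift_tensor[OF cbilinear_mult_inner],
      simp_all only: distrib_right tensor_add_left tensor_add_right
      mult_scaleC_left tensor_scale_left tensor_scale_right)

lemma tensor_mult_tensor: "tensor_mult (a \<otimes> b) (c \<otimes> d) = (a * c) \<otimes> (b * d)"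
  unfolding tensor_mult_def
  by (subst tensor_lift_tensor[OF cbilinear_mult_outer],
      subst tensor_lift_tensor[OF cbilinear_mult_inner]) (rule refl)

lemma tensor_mult_left: "clinear (\<lambda>s. tensor_mult s t)"
  unfolding tensor_mult_def by (rule clinear_tensor_lift[OF cbilinear_mult_outer])

lemma tensor_mult_right: "clinear (tensor_mult s)"
proof -
  have *: "clinear (tensor_mult (a \<otimes> b))" for a :: 'a and b :: 'b
    unfolding tensor_mult_def tensor_lift_tensor[OF cbilinear_mult_outer]
    by (rule clinear_tensor_lift[OF cbilinear_mult_inner])
  show ?thesis
    unfolding clinear_iff
    by (intro conjI allI; rule tensor_eqI[of _ _ s];
        (intro clinear_plus clinear_scaleC tensor_mult_left)?)
       (simp_all add: clinear_add[OF *] clinear_scale[OF *])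
qed

lemma tensor_mult_assoc: "tensor_mult (tensor_mult s t) u = tensor_mult s (tensor_mult t u)"
proof -
  have l: "clinear (\<lambda>s. tensor_mult (f s) v)" if "clinear f" for v and f :: "'c::complex_vector \<Rightarrow> ('a, 'b) tensor"
    by (rule clinear_compose[OF tensor_mult_left that])
  have r: "clinear (\<lambda>s. tensor_mult v (f s))" if "clinear f" for v and f :: "'c::complex_vector \<Rightarrow> ('a, 'b) tensor"
    by (rule clinear_compose[OF tensor_mult_right that])
  have i: "clinear (\<lambda>x. x)" for x by (simp add: clinear_iff)
  have 1: "tensor_mult (tensor_mult (a \<otimes> b) (c \<otimes> d)) u = tensor_mult (a \<otimes> b) (tensor_mult (c \<otimes> d) u)" for a b c d
    by (rule tensor_eqI[of _ _ u]; (intro l r tensor_mult_right)?) (simp add: tensor_mult_tensor mult.assoc)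
  have 2: "tensor_mult (tensor_mult (a \<otimes> b) t) u = tensor_mult (a \<otimes> b) (tensor_mult t u)" for a b
    by (rule tensor_eqI[of _ _ t]; (intro l r tensor_mult_right tensor_mult_left)?) (rule 1)
  show ?thesis
    by (rule tensor_eqI[of _ _ s]; (intro l r tensor_mult_right tensor_mult_left)?) (rule 2)
qed

lemma separating_functional:
  fixes x :: "'c::complex_vector"
  assumes "x \<noteq> 0"
  obtains \<phi> :: "'c \<Rightarrow> complex" where "clinear \<phi>" "\<phi> x = 1"
proof -
  interpret vector_space_pair "scaleC :: complex \<Rightarrow> 'c \<Rightarrow> 'c" "scaleC :: complex \<Rightarrow> complex \<Rightarrow> complex" ..
  have "complex_vector.independent {x}"
    using assms by (simp add: complex_vector.independent_insert)
  from linear_independent_extend[OF this, of "\<lambda>_. 1"] that show thesis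
    by (auto simp: clinear_def)
qed

instantiation tensor :: (complex_algebra_1, complex_algebra_1) complex_algebra_1
begin

definition one_tensor :: "('a, 'b) tensor"
  where "one_tensor = 1 \<otimes> 1"

definition times_tensor :: "('a, 'b) tensor \<Rightarrow> ('a, 'b) tensor \<Rightarrow> ('a, 'b) tensor"
  where "times_tensor s t = tensor_lift (\<lambda>a b. tensor_lift (\<lambda>c d. (a * c) \<otimes> (b * d)) t) s"

instance
proof
  fix s t u :: "('a, 'b) tensor" and c :: complex
  have times: "(*) = (tensor_mult :: ('a, 'b) tensor \<Rightarrow> _)"
    by (simp add: fun_eq_iff tensor_mult_def times_tensor_def)
  note left = tensor_mult_left[of u] and right = tensor_mult_right[of s]
  show "s * t * u = s * (t * u)" by (simp add: times tensor_mult_assoc)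
  show "(s + t) * u = s * u + t * u" by (simp add: times clinear_add[OF tensor_mult_left])
  show "s * (t + u) = s * t + s * u" by (simp add: times clinear_add[OF tensor_mult_right])
  show "(c *\<^sub>C s) * t = c *\<^sub>C (s * t)" by (simp add: times clinear_scale[OF tensor_mult_left])
  show "s * (c *\<^sub>C t) = c *\<^sub>C (s * t)" by (simp add: times clinear_scale[OF tensor_mult_right])
  have i: "clinear (\<lambda>x :: ('a, 'b) tensor. x)" by (simp add: clinear_iff)
  show "1 * s = s" unfolding times one_tensor_def
    by (rule tensor_eqI[OF tensor_mult_right i]) (simp add: tensor_mult_tensor)
  show "s * 1 = s" unfolding times one_tensor_def
    by (rule tensor_eqI[OF tensor_mult_left i]) (simp add: tensor_mult_tensor)
  show "(0 :: ('a, 'b) tensor) \<noteq> 1"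
  proof
    assume 01: "(0 :: ('a, 'b) tensor) = 1"
    obtain \<phi> :: "'a \<Rightarrow> complex" where \<phi>: "clinear \<phi>" "\<phi> 1 = 1"
      using separating_functional[OF one_neq_zero] by blast
    obtain \<psi> :: "'b \<Rightarrow> complex" where \<psi>: "clinear \<psi>" "\<psi> 1 = 1"
      using separating_functional[OF one_neq_zero] by blast
    have b: "cbilinear (\<lambda>a b. \<phi> a * \<psi> b)"
      using \<phi>(1) \<psi>(1) by (simp add: cbilinear_def clinear_iff algebra_simps scaleC_complex_def)
    have "tensor_lift (\<lambda>a b. \<phi> a * \<psi> b) 1 = 1"
      by (simp add: one_tensor_def b \<phi> \<psi>)
    moreover have "tensor_lift (\<lambda>a b. \<phi> a * \<psi> b) 0 = 0"
      by (rule clinear_0[OF clinear_tensor_lift[OF b]])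
    ultimately show False using 01 by simp
  qed
qed

end

lemma tensor_times_tensor: "(a \<otimes> b) * (c \<otimes> d) = (a * c) \<otimes> (b * d)"
  unfolding times_tensor_def tensor_mult_def[symmetric] by (rule tensor_mult_tensor)

section \<open>Complex Lie algebras and their enveloping algebras\<close>

class complex_lie_algebra = complex_vector +
  fixes lie_bracket :: "'a \<Rightarrow> 'a \<Rightarrow> 'a" (\<open>\<^bold>[_, _\<^bold>]\<close>)
  assumes lie_add_left: "\<^bold>[x + y, z\<^bold>] = \<^bold>[x, z\<^bold>] + \<^bold>[y, z\<^bold>]"
    and lie_add_right: "\<^bold>[x, y + z\<^bold>] = \<^bold>[x, y\<^bold>] + \<^bold>[x, z\<^bold>]"
    and lie_scale_left: "\<^bold>[c *\<^sub>C x, y\<^bold>] = c *\<^sub>C \<^bold>[x, y\<^bold>]"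
    and lie_scale_right: "\<^bold>[x, c *\<^sub>C y\<^bold>] = c *\<^sub>C \<^bold>[x, y\<^bold>]"
    and lie_self: "\<^bold>[x, x\<^bold>] = 0"
    and lie_jacobi: "\<^bold>[x, \<^bold>[y, z\<^bold>]\<^bold>] + \<^bold>[y, \<^bold>[z, x\<^bold>]\<^bold>] + \<^bold>[z, \<^bold>[x, y\<^bold>]\<^bold>] = 0"

text \<open>
  Words under concatenation: the monoid algebra \<open>'g list \<Rightarrow>\<^sub>0 complex\<close> is the free associative
  algebra on the underlying set of \<open>'g\<close>.  The relations below also impose linearity of
  \<open>'g \<rightarrow> U('g)\<close>, so that the quotient is the usual enveloping algebra.
\<close>

instantiation list :: (type) monoid_add
begin
definition zero_list :: "'a list" where "zero_list = []"
definition plus_list :: "'a list \<Rightarrow> 'a list \<Rightarrow> 'a list" where "plus_list = (@)"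
instance by standard (simp_all add: zero_list_def plus_list_def)
end

definition uea_relations :: "('g::complex_lie_algebra list \<Rightarrow>\<^sub>0 complex) set"
  where "uea_relations =
    {Poly_Mapping.single [x + y] 1 - Poly_Mapping.single [x] 1 - Poly_Mapping.single [y] 1 | x y. True} \<union>
    {Poly_Mapping.single [c *\<^sub>C x] 1 - Poly_Mapping.single [x] c | c x. True} \<union>
    {Poly_Mapping.single [x, y] 1 - Poly_Mapping.single [y, x] 1 - Poly_Mapping.single [\<^bold>[x, y\<^bold>]] 1 | x y. True}"

definition uea_ideal_gens :: "('g::complex_lie_algebra list \<Rightarrow>\<^sub>0 complex) set"
  where "uea_ideal_gens = {p * r * q | p r q. r \<in> uea_relations}"

lemma poly_mapping_scale_left: "(c *\<^sub>C p) * q = c *\<^sub>C (p * q)"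
  and poly_mapping_scale_right: "p * (c *\<^sub>C q) = c *\<^sub>C (p * q)"
  for p q :: "'k::monoid_add \<Rightarrow>\<^sub>0 complex"
proof -
  have s: "c *\<^sub>C r = Poly_Mapping.single 0 c * r" for r :: "'k \<Rightarrow>\<^sub>0 complex"
    by (simp add: scaleC_poly_mapping_def scaleC_complex_def mult_map_scale_conv_mult)
  have comm: "r * Poly_Mapping.single 0 c = Poly_Mapping.single 0 c * r" for r :: "'k \<Rightarrow>\<^sub>0 complex"
    by (subst (1 2) poly_mapping_decompose[of r])
       (simp add: sum_distrib_left sum_distrib_right mult_single mult.commute)
  show "(c *\<^sub>C p) * q = c *\<^sub>C (p * q)" by (simp add: s mult.assoc)
  show "p * (c *\<^sub>C q) = c *\<^sub>C (p * q)" by (simp add: s comm flip: mult.assoc)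
qed

lemma uea_ideal_mult:
  assumes "r \<in> cspan uea_ideal_gens"
  shows "p * r \<in> cspan uea_ideal_gens" "r * q \<in> cspan uea_ideal_gens"
proof -
  have gen: "p * g \<in> uea_ideal_gens \<and> g * q \<in> uea_ideal_gens"
    if "g \<in> uea_ideal_gens" for g :: "'a list \<Rightarrow>\<^sub>0 complex"
  proof -
    from that obtain u s v where "g = u * s * v" "s \<in> uea_relations"
      unfolding uea_ideal_gens_def by blast
    then have "p * g = (p * u) * s * v" "g * q = u * s * (v * q)"
      by (simp_all add: mult.assoc)
    with \<open>s \<in> uea_relations\<close> show ?thesis
      unfolding uea_ideal_gens_def by blast
  qed
  from assms show "p * r \<in> cspan uea_ideal_gens"
    by (induction rule: complex_vector.span_induct_alt)
       (simp_all add: complex_vector.span_zero distrib_left poly_mapping_scale_right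
        complex_vector.span_add complex_vector.span_scale complex_vector.span_base gen)
  from assms show "r * q \<in> cspan uea_ideal_gens"
    by (induction rule: complex_vector.span_induct_alt)
       (simp_all add: complex_vector.span_zero distrib_right poly_mapping_scale_left
        complex_vector.span_add complex_vector.span_scale complex_vector.span_base gen)
qed

lemma free_lift_one_mult:
  fixes b :: "'k::monoid_add \<Rightarrow> 'a::complex_algebra_1"
  assumes "\<And>k l. b (k + l) = b k * b l"
  shows "free_lift b (p * q) = free_lift b p * free_lift b q"
proof -
  note l = clinear_free_lift[of b]
  have 1: "free_lift b (Poly_Mapping.single k 1 * q) = free_lift b (Poly_Mapping.single k 1) * free_lift b q" for k
    by (rule clinear_free_eqI)
       (simp_all add: clinear_iff clinear_add[OF l] clinear_scale[OF l] distrib_left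
        poly_mapping_scale_right mult_scaleC_right mult_single assms scaleC_one)
  show ?thesis
    by (rule clinear_free_eqI[of _ _ p])
       (simp_all only: 1, simp_all add: clinear_iff clinear_add[OF l] clinear_scale[OF l] distrib_right
        poly_mapping_scale_left mult_scaleC_left)
qed

quotient_type (overloaded) 'g uea = "'g::complex_lie_algebra list \<Rightarrow>\<^sub>0 complex"
  / "\<lambda>p q. p - q \<in> cspan uea_ideal_gens"
  by (rule equivp_span)

instantiation uea :: (complex_lie_algebra) complex_algebra_1
begin
lift_definition zero_uea :: "'a uea" is 0 .
lift_definition one_uea :: "'a uea" is 1 .
lift_definition plus_uea :: "'a uea \<Rightarrow> 'a uea \<Rightarrow> 'a uea" is "(+)"
  by (rule span_diff_add)
lift_definition minus_uea :: "'a uea \<Rightarrow> 'a uea \<Rightarrow> 'a uea" is "(-)"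
  by (rule span_diff_diff)
lift_definition uminus_uea :: "'a uea \<Rightarrow> 'a uea" is uminus
  by (rule span_diff_uminus)
lift_definition scaleC_uea :: "complex \<Rightarrow> 'a uea \<Rightarrow> 'a uea" is scaleC
  by (rule span_diff_scale)
lift_definition times_uea :: "'a uea \<Rightarrow> 'a uea \<Rightarrow> 'a uea" is "(*)"
proof -
  fix p p' q q' :: "'a list \<Rightarrow>\<^sub>0 complex"
  assume "p - p' \<in> cspan uea_ideal_gens" "q - q' \<in> cspan uea_ideal_gens"
  then have "(p - p') * q + p' * (q - q') \<in> cspan uea_ideal_gens"
    by (intro complex_vector.span_add uea_ideal_mult)
  then show "p * q - p' * q' \<in> cspan uea_ideal_gens"
    by (simp add: algebra_simps)
qed
instance
proof
  fix a b c :: "'a uea" and x y :: complex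
  note z = complex_vector.span_zero
  show "a + b + c = a + (b + c)" "a + b = b + a" "0 + a = a" "- a + a = 0" "a - b = a + - b"
    by (transfer, simp add: z algebra_simps)+
  show "x *\<^sub>C (a + b) = x *\<^sub>C a + x *\<^sub>C b" by transfer (simp add: z scaleC_add_right)
  show "(x + y) *\<^sub>C a = x *\<^sub>C a + y *\<^sub>C a" by transfer (simp add: z scaleC_add_left)
  show "x *\<^sub>C y *\<^sub>C a = (x * y) *\<^sub>C a" by transfer (simp add: z scaleC_scaleC)
  show "1 *\<^sub>C a = a" by transfer (simp add: z scaleC_one)
  show "a * b * c = a * (b * c)" by transfer (simp add: z mult.assoc)
  show "1 * a = a" "a * 1 = a" by (transfer, simp add: z)+
  show "(a + b) * c = a * c + b * c" by transfer (simp add: z distrib_right)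
  show "a * (b + c) = a * b + a * c" by transfer (simp add: z distrib_left)
  show "(x *\<^sub>C a) * b = x *\<^sub>C (a * b)" by transfer (simp add: z poly_mapping_scale_left)
  show "a * (x *\<^sub>C b) = x *\<^sub>C (a * b)" by transfer (simp add: z poly_mapping_scale_right)
  define \<epsilon> :: "('a list \<Rightarrow>\<^sub>0 complex) \<Rightarrow> complex"
    where "\<epsilon> = free_lift (\<lambda>w. if w = [] then 1 else 0)"
  have lin: "clinear \<epsilon>"
    unfolding \<epsilon>_def by (rule clinear_free_lift)
  have mult: "\<epsilon> (p * q) = \<epsilon> p * \<epsilon> q" for p q
    unfolding \<epsilon>_def by (rule free_lift_one_mult) (simp add: plus_list_def)
  have single: "\<epsilon> (Poly_Mapping.single (u # w) d) = 0" for u w d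
    by (simp add: \<epsilon>_def scaleC_complex_def)
  have rel: "\<epsilon> r = 0" if "r \<in> uea_relations" for r
    using that unfolding uea_relations_def by (auto simp: clinear_diff[OF lin] single)
  have "\<epsilon> g = 0" if "g \<in> uea_ideal_gens" for g
    using that unfolding uea_ideal_gens_def by (auto simp: mult rel)
  then have "\<epsilon> g = 0" if "g \<in> cspan uea_ideal_gens" for g
    using clinear_vanishes_on_span[OF lin _ that] by blast
  moreover have "\<epsilon> (0 - 1) = -1"
    by (simp add: clinear_uminus[OF lin])
       (simp add: \<epsilon>_def scaleC_complex_def zero_list_def flip: single_one)
  ultimately have "0 - 1 \<notin> cspan (uea_ideal_gens :: ('a list \<Rightarrow>\<^sub>0 complex) set)"
    by force
  then show "(0 :: 'a uea) \<noteq> 1"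
    by transfer
qed
end

lift_definition uea_of :: "'g::complex_lie_algebra \<Rightarrow> 'g uea"
  is "\<lambda>x. Poly_Mapping.single [x] 1" .

lemma uea_of_add: "uea_of (x + y) = uea_of x + uea_of y"
  and uea_of_scale: "uea_of (c *\<^sub>C x) = c *\<^sub>C uea_of x"
  and uea_of_bracket: "uea_of \<^bold>[x, y\<^bold>] = uea_of x * uea_of y - uea_of y * uea_of x"
proof -
  have rel: "r \<in> uea_relations \<Longrightarrow> r \<in> cspan uea_ideal_gens" for r :: "'a list \<Rightarrow>\<^sub>0 complex"
    by (rule complex_vector.span_base, unfold uea_ideal_gens_def)
       (rule CollectI, rule exI[of _ 1], rule exI[of _ r], rule exI[of _ 1], simp)
  show "uea_of (x + y) = uea_of x + uea_of y"
    by transfer (subst diff_diff_eq[symmetric], rule rel, unfold uea_relations_def, blast)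
  show "uea_of (c *\<^sub>C x) = c *\<^sub>C uea_of x"
    by transfer (unfold scaleC_single mult_1_right, rule rel, unfold uea_relations_def, blast)
  have "uea_of x * uea_of y - uea_of y * uea_of x = uea_of \<^bold>[x, y\<^bold>]"
    by transfer (simp only: mult_single plus_list_def append_Cons append_Nil mult_1_right,
      rule rel, unfold uea_relations_def, blast)
  then show "uea_of \<^bold>[x, y\<^bold>] = uea_of x * uea_of y - uea_of y * uea_of x" ..
qed

text \<open>
  The coproduct is the algebra morphism \<open>U(g) \<rightarrow> U(g) \<otimes> U(g)\<close> for which the elements of \<open>g\<close> are
  primitive.
\<close>

definition primitive :: "'g::complex_lie_algebra \<Rightarrow> ('g uea, 'g uea) tensor"
  where "primitive x = uea_of x \<otimes> 1 + 1 \<otimes> uea_of x"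

lemma primitive_bracket: "primitive x * primitive y - primitive y * primitive x = primitive \<^bold>[x, y\<^bold>]"
proof -
  have d: "(a - b) \<otimes> c = a \<otimes> c - b \<otimes> c" "c \<otimes> (a - b) = c \<otimes> a - c \<otimes> b" for a b c :: "'a uea"
    using cbilinear_tensor unfolding cbilinear_def by (blast intro: clinear_diff[of "\<lambda>x. x \<otimes> c"] clinear_diff[of "tensor c"])+
  show ?thesis
    by (simp add: primitive_def distrib_left distrib_right tensor_times_tensor uea_of_bracket d)
qed

definition free_coproduct :: "('g::complex_lie_algebra list \<Rightarrow>\<^sub>0 complex) \<Rightarrow> ('g uea, 'g uea) tensor"
  where "free_coproduct = free_lift (\<lambda>w. prod_list (map primitive w))"

lemma clinear_free_coproduct: "clinear free_coproduct"
  unfolding free_coproduct_def by (rule clinear_free_lift)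

lemma free_coproduct_mult: "free_coproduct (p * q) = free_coproduct p * free_coproduct q"
  unfolding free_coproduct_def by (rule free_lift_one_mult) (simp add: plus_list_def)

lemma free_coproduct_ideal:
  assumes "p \<in> cspan uea_ideal_gens"
  shows "free_coproduct p = 0"
proof -
  note l = clinear_diff[OF clinear_free_coproduct]
  have single: "free_coproduct (Poly_Mapping.single w c) = c *\<^sub>C prod_list (map primitive w)" for w :: "'a list" and c
    by (simp add: free_coproduct_def)
  have "free_coproduct r = 0" if "r \<in> uea_relations" for r :: "'a list \<Rightarrow>\<^sub>0 complex"
    using that unfolding uea_relations_def
    by (auto simp: l single scaleC_one primitive_bracket)
       (simp_all add: primitive_def uea_of_add uea_of_scale tensor_add_left tensor_add_right
        tensor_scale_left tensor_scale_right scaleC_add_right)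
  then have "free_coproduct g = 0" if "g \<in> uea_ideal_gens" for g :: "'a list \<Rightarrow>\<^sub>0 complex"
    using that unfolding uea_ideal_gens_def by (auto simp: free_coproduct_mult)
  from clinear_vanishes_on_span[OF clinear_free_coproduct this assms] show ?thesis .
qed

lift_definition coproduct :: "'g::complex_lie_algebra uea \<Rightarrow> ('g uea, 'g uea) tensor"
  is free_coproduct
  using free_coproduct_ideal clinear_diff[OF clinear_free_coproduct] by (metis right_minus_eq)

lemma clinear_coproduct: "clinear coproduct"
  unfolding clinear_iff
  by (intro conjI allI; transfer)
     (simp_all add: clinear_add[OF clinear_free_coproduct] clinear_scale[OF clinear_free_coproduct])

lemma coproduct_one: "coproduct 1 = 1 \<otimes> 1"
  by transfer (simp add: free_coproduct_def scaleC_one zero_list_def one_tensor_def flip: single_one)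

lemma coproduct_mult: "coproduct (u * v) = coproduct u * coproduct v"
  by transfer (rule free_coproduct_mult)

lemma coproduct_uea_of: "coproduct (uea_of x) = uea_of x \<otimes> 1 + 1 \<otimes> uea_of x"
  by transfer (simp add: free_coproduct_def scaleC_one primitive_def)

section \<open>Functions on the formal group\<close>

text \<open>\<open>\<complex>[[G]] = U(g)\<^sup>*\<close>, with the product dual to the coproduct.\<close>

typedef (overloaded) 'g formal_function =
  "{\<phi> :: 'g::complex_lie_algebra uea \<Rightarrow> complex. clinear \<phi>}"
  by (rule exI[of _ "\<lambda>_. 0"]) (simp add: clinear_iff)

setup_lifting type_definition_formal_function

instantiation formal_function :: (complex_lie_algebra) "{complex_vector, times}"
begin
lift_definition zero_formal_function :: "'a formal_function" is "\<lambda>_. 0"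
  by (simp add: clinear_iff)
lift_definition plus_formal_function :: "'a formal_function \<Rightarrow> 'a formal_function \<Rightarrow> 'a formal_function"
  is "\<lambda>f g u. f u + g u"
  by (rule clinear_plus)
lift_definition minus_formal_function :: "'a formal_function \<Rightarrow> 'a formal_function \<Rightarrow> 'a formal_function"
  is "\<lambda>f g u. f u - g u"
  by (simp add: clinear_iff complex_vector.scale_right_diff_distrib)
lift_definition uminus_formal_function :: "'a formal_function \<Rightarrow> 'a formal_function"
  is "\<lambda>f u. - f u"
  by (simp add: clinear_iff)
lift_definition scaleC_formal_function :: "complex \<Rightarrow> 'a formal_function \<Rightarrow> 'a formal_function"
  is "\<lambda>c f u. c *\<^sub>C f u"
  by (rule clinear_scaleC)
lift_definition times_formal_function :: "'a formal_function \<Rightarrow> 'a formal_function \<Rightarrow> 'a formal_function"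
  is "\<lambda>f g u. tensor_lift (\<lambda>v w. f v * g w) (coproduct u)"
  by (rule clinear_compose[OF clinear_tensor_lift clinear_coproduct])
     (simp add: cbilinear_def clinear_iff algebra_simps scaleC_complex_def)
instance
  by standard (transfer, simp add: fun_eq_iff scaleC_complex_def algebra_simps)+
end

text \<open>
  \<open>(L_a f)(x) = d/d\<epsilon> f (e\<^bsup>-\<epsilon>a\<^esup> x)\<close> and \<open>(R_a f)(x) = d/d\<epsilon> f (x e\<^bsup>\<epsilon>a\<^esup>)\<close> at \<open>\<epsilon> = 0\<close>; on \<open>U(g)\<close> the
  derivative picks out the coefficient of \<open>\<epsilon>\<close> in \<open>e\<^bsup>\<epsilon>a\<^esup> = 1 + \<epsilon>a + \<dots>\<close>.
\<close>

lift_definition left_der :: "'g::complex_lie_algebra \<Rightarrow> 'g formal_function \<Rightarrow> 'g formal_function"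
  is "\<lambda>a f u. f (- uea_of a * u)"
  by (rule clinear_compose) (simp_all add: clinear_iff distrib_left mult_scaleC_right)

lift_definition right_der :: "'g::complex_lie_algebra \<Rightarrow> 'g formal_function \<Rightarrow> 'g formal_function"
  is "\<lambda>a f u. f (u * uea_of a)"
  by (simp add: clinear_iff distrib_right mult_scaleC_left)

text \<open>\<open>m (L\<^sup>\<otimes>\<^sup>2(\<tau>) (f \<otimes> g))\<close> and \<open>m (R\<^sup>\<otimes>\<^sup>2(\<tau>) (f \<otimes> g))\<close> for \<open>\<tau> \<in> g \<otimes> g\<close>.\<close>

definition left_action ::
    "('g::complex_lie_algebra, 'g) tensor \<Rightarrow> 'g formal_function \<Rightarrow> 'g formal_function \<Rightarrow> 'g formal_function"
  where "left_action \<tau> f g = tensor_lift (\<lambda>a b. left_der a f * left_der b g) \<tau>"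

definition right_action ::
    "('g::complex_lie_algebra, 'g) tensor \<Rightarrow> 'g formal_function \<Rightarrow> 'g formal_function \<Rightarrow> 'g formal_function"
  where "right_action \<tau> f g = tensor_lift (\<lambda>a b. right_der a f * right_der b g) \<tau>"

section \<open>Simple Lie algebras and Levi subalgebras\<close>

definition lie_ideal :: "'g::complex_lie_algebra set \<Rightarrow> bool"
  where "lie_ideal J \<longleftrightarrow> complex_vector.subspace J \<and> (\<forall>x. \<forall>y\<in>J. \<^bold>[x, y\<^bold>] \<in> J)"

definition simple_lie_algebra :: "'g::complex_lie_algebra itself \<Rightarrow> bool"
  where "simple_lie_algebra _ \<longleftrightarrow>
    (\<exists>B :: 'g set. finite B \<and> cspan B = UNIV) \<and>
    (\<exists>x y :: 'g. \<^bold>[x, y\<^bold>] \<noteq> 0) \<and>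
    (\<forall>J :: 'g set. lie_ideal J \<longrightarrow> J = {0} \<or> J = UNIV)"

definition lie_product :: "'g::complex_lie_algebra set \<Rightarrow> 'g set \<Rightarrow> 'g set"
  where "lie_product A B = cspan {\<^bold>[x, y\<^bold>] | x y. x \<in> A \<and> y \<in> B}"

text \<open>
  The usual definition for semisimple Lie algebras: a maximal abelian subalgebra all of whose
  elements are \<open>ad\<close>-diagonalizable.
\<close>

definition cartan_subalgebra :: "'g::complex_lie_algebra set \<Rightarrow> bool"
  where "cartan_subalgebra H \<longleftrightarrow> complex_vector.subspace H \<and>
    (\<forall>x\<in>H. \<forall>y\<in>H. \<^bold>[x, y\<^bold>] = 0) \<and>
    (\<forall>x. (\<forall>h\<in>H. \<^bold>[h, x\<^bold>] = 0) \<longrightarrow> x \<in> H) \<and>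
    (\<forall>h\<in>H. cspan {x. \<exists>c. \<^bold>[h, x\<^bold>] = c *\<^sub>C x} = UNIV)"

definition endo_trace :: "('v::complex_vector \<Rightarrow> 'v) \<Rightarrow> complex"
  where "endo_trace F =
    (\<Sum>b\<in>complex_vector.extend_basis {}. complex_vector.representation (complex_vector.extend_basis {}) (F b) b)"

definition killing :: "'g::complex_lie_algebra \<Rightarrow> 'g \<Rightarrow> complex"
  where "killing x y = endo_trace (\<lambda>z. \<^bold>[x, \<^bold>[y, z\<^bold>]\<^bold>])"

text \<open>
  Linear forms on a subspace \<open>V\<close> are represented by functions on the whole space that vanish
  outside \<open>V\<close> (in general these are not linear on the whole space).
\<close>

definition dual_on :: "'v::complex_vector set \<Rightarrow> ('v \<Rightarrow> complex) set"
  where "dual_on V = {\<phi>. (\<forall>x\<in>V. \<forall>y\<in>V. \<phi> (x + y) = \<phi> x + \<phi> y) \<and>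
    (\<forall>c. \<forall>x\<in>V. \<phi> (c *\<^sub>C x) = c * \<phi> x) \<and> (\<forall>x. x \<notin> V \<longrightarrow> \<phi> x = 0)}"

definition root_space :: "'g::complex_lie_algebra set \<Rightarrow> ('g \<Rightarrow> complex) \<Rightarrow> 'g set"
  where "root_space H \<beta> = {x. \<forall>h\<in>H. \<^bold>[h, x\<^bold>] = \<beta> h *\<^sub>C x}"

definition roots :: "'g::complex_lie_algebra set \<Rightarrow> ('g \<Rightarrow> complex) set"
  where "roots H = {\<beta> \<in> dual_on H. \<beta> \<noteq> (\<lambda>_. 0) \<and> root_space H \<beta> \<noteq> {0}}"

definition nat_combination :: "(nat \<Rightarrow> 'g \<Rightarrow> complex) \<Rightarrow> nat set \<Rightarrow> (nat \<Rightarrow> nat) \<Rightarrow> 'g \<Rightarrow> complex"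
  where "nat_combination \<alpha> S n = (\<lambda>x. \<Sum>s\<in>S. of_nat (n s) * \<alpha> s x)"

definition simple_roots :: "'g::complex_lie_algebra set \<Rightarrow> nat \<Rightarrow> (nat \<Rightarrow> 'g \<Rightarrow> complex) \<Rightarrow> bool"
  where "simple_roots H r \<alpha> \<longleftrightarrow>
    \<alpha> ` {1..r} \<subseteq> roots H \<and>
    (\<forall>c. (\<forall>x. (\<Sum>s\<in>{1..r}. c s * \<alpha> s x) = 0) \<longrightarrow> (\<forall>s\<in>{1..r}. c s = 0)) \<and>
    (\<forall>\<beta>\<in>roots H. \<exists>n. \<beta> = nat_combination \<alpha> {1..r} n \<or> \<beta> = - nat_combination \<alpha> {1..r} n)"

text \<open>
  With \<open>S = {1..r}\<close> these are the positive roots of \<open>g\<close>, with \<open>S = I\<close> those of the Levi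
  subalgebra attached to \<open>I\<close>.
\<close>

definition pos_roots :: "'g::complex_lie_algebra set \<Rightarrow> (nat \<Rightarrow> 'g \<Rightarrow> complex) \<Rightarrow> nat set \<Rightarrow> ('g \<Rightarrow> complex) set"
  where "pos_roots H \<alpha> S = {\<beta> \<in> roots H. \<exists>n. \<beta> = nat_combination \<alpha> S n}"

definition levi :: "'g::complex_lie_algebra set \<Rightarrow> (nat \<Rightarrow> 'g \<Rightarrow> complex) \<Rightarrow> nat set \<Rightarrow> 'g set"
  where "levi H \<alpha> I = cspan (H \<union> (\<Union>\<beta>\<in>pos_roots H \<alpha> I. root_space H \<beta> \<union> root_space H (- \<beta>)))"

definition levi_center :: "'g::complex_lie_algebra set \<Rightarrow> (nat \<Rightarrow> 'g \<Rightarrow> complex) \<Rightarrow> nat set \<Rightarrow> 'g set"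
  where "levi_center H \<alpha> I = {x \<in> levi H \<alpha> I. \<forall>y\<in>levi H \<alpha> I. \<^bold>[x, y\<^bold>] = 0}"

definition restrict_center ::
    "'g::complex_lie_algebra set \<Rightarrow> (nat \<Rightarrow> 'g \<Rightarrow> complex) \<Rightarrow> nat set \<Rightarrow> ('g \<Rightarrow> complex) \<Rightarrow> 'g \<Rightarrow> complex"
  where "restrict_center H \<alpha> I \<beta> = (\<lambda>x. if x \<in> levi_center H \<alpha> I then \<beta> x else 0)"

text \<open>\<open>\<Delta>\<^sub>+(g) - \<Delta>\<^sub>+(l)\<close> and the set \<open>\<Delta>\<^sub>+(g; l)\<close> of restrictions of its elements to the center.\<close>

definition outer_roots ::
    "'g::complex_lie_algebra set \<Rightarrow> nat \<Rightarrow> (nat \<Rightarrow> 'g \<Rightarrow> complex) \<Rightarrow> nat set \<Rightarrow> ('g \<Rightarrow> complex) set"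
  where "outer_roots H r \<alpha> I = pos_roots H \<alpha> {1..r} - pos_roots H \<alpha> I"

definition relative_roots ::
    "'g::complex_lie_algebra set \<Rightarrow> nat \<Rightarrow> (nat \<Rightarrow> 'g \<Rightarrow> complex) \<Rightarrow> nat set \<Rightarrow> ('g \<Rightarrow> complex) set"
  where "relative_roots H r \<alpha> I = restrict_center H \<alpha> I ` outer_roots H r \<alpha> I"

definition relative_coeffs ::
    "'g::complex_lie_algebra set \<Rightarrow> nat \<Rightarrow> (nat \<Rightarrow> 'g \<Rightarrow> complex) \<Rightarrow> nat set \<Rightarrow> ('g \<Rightarrow> complex) \<Rightarrow> nat \<Rightarrow> nat"
  where "relative_coeffs H r \<alpha> I \<theta> = (THE n. (\<forall>s. s \<notin> {1..r} - I \<longrightarrow> n s = 0) \<and>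
    \<theta> = nat_combination (\<lambda>s. restrict_center H \<alpha> I (\<alpha> s)) ({1..r} - I) n)"

definition torus_character ::
    "'g::complex_lie_algebra set \<Rightarrow> nat \<Rightarrow> (nat \<Rightarrow> 'g \<Rightarrow> complex) \<Rightarrow> nat set \<Rightarrow>
      ('g \<Rightarrow> complex) \<Rightarrow> (nat \<Rightarrow> complex) \<Rightarrow> complex"
  where "torus_character H r \<alpha> I \<theta> t = (\<Prod>s\<in>{1..r} - I. t s ^ relative_coeffs H r \<alpha> I \<theta> s)"

text \<open>The form on \<open>h\<^sup>*\<close> dual to the restriction of the Killing form to \<open>h\<close>.\<close>

definition killing_dual :: "'g::complex_lie_algebra set \<Rightarrow> ('g \<Rightarrow> complex) \<Rightarrow> 'g"
  where "killing_dual H \<phi> = (THE h. h \<in> H \<and> (\<forall>x\<in>H. killing h x = \<phi> x))"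

definition dual_form :: "'g::complex_lie_algebra set \<Rightarrow> ('g \<Rightarrow> complex) \<Rightarrow> ('g \<Rightarrow> complex) \<Rightarrow> complex"
  where "dual_form H \<phi> \<psi> = killing (killing_dual H \<phi>) (killing_dual H \<psi>)"

text \<open>
  \<open>z\<^sup>* \<subseteq> h\<^sup>*\<close>, where forms on \<open>z\<close> are extended by zero on \<open>h \<inter> [l, l]\<close>.  Regularity refers to
  \<open>(\<chi>, \<theta>)\<close> for \<open>\<theta> \<in> \<Delta>\<^sub>+(g; l)\<close>, which is by definition \<open>(\<chi>, \<beta>)\<close> for any \<open>\<beta>\<close> restricting to \<open>\<theta>\<close>.
\<close>

definition levi_characters ::
    "'g::complex_lie_algebra set \<Rightarrow> (nat \<Rightarrow> 'g \<Rightarrow> complex) \<Rightarrow> nat set \<Rightarrow> ('g \<Rightarrow> complex) set"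
  where "levi_characters H \<alpha> I =
    {\<xi> \<in> dual_on H. \<forall>x \<in> H \<inter> lie_product (levi H \<alpha> I) (levi H \<alpha> I). \<xi> x = 0}"

definition regular_character ::
    "'g::complex_lie_algebra set \<Rightarrow> nat \<Rightarrow> (nat \<Rightarrow> 'g \<Rightarrow> complex) \<Rightarrow> nat set \<Rightarrow> ('g \<Rightarrow> complex) \<Rightarrow> bool"
  where "regular_character H r \<alpha> I \<xi> \<longleftrightarrow>
    (\<forall>\<beta>\<in>outer_roots H r \<alpha> I. dual_form H \<xi> \<beta> \<notin> {2 * of_real pi * \<i> * of_int k | k :: int. True})"

section \<open>The standard Lie bialgebra structure and the Poisson brackets\<close>

definition root_vectors ::
    "'g::complex_lie_algebra set \<Rightarrow> nat \<Rightarrow> (nat \<Rightarrow> 'g \<Rightarrow> complex) \<Rightarrow>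
      (('g \<Rightarrow> complex) \<Rightarrow> 'g) \<Rightarrow> (('g \<Rightarrow> complex) \<Rightarrow> 'g) \<Rightarrow> bool"
  where "root_vectors H r \<alpha> e f \<longleftrightarrow> (\<forall>\<beta>\<in>pos_roots H \<alpha> {1..r}.
    e \<beta> \<in> root_space H \<beta> \<and> f \<beta> \<in> root_space H (- \<beta>) \<and> killing (e \<beta>) (f \<beta>) = 1)"

definition wedge :: "'v::complex_vector \<Rightarrow> 'v \<Rightarrow> ('v, 'v) tensor"
  where "wedge x y = x \<otimes> y - y \<otimes> x"

definition wedge_square :: "('v::complex_vector, 'v) tensor set"
  where "wedge_square = cspan {wedge x y | x y. True}"

definition standard_r ::
    "'g::complex_lie_algebra set \<Rightarrow> nat \<Rightarrow> (nat \<Rightarrow> 'g \<Rightarrow> complex) \<Rightarrow>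
      (('g \<Rightarrow> complex) \<Rightarrow> 'g) \<Rightarrow> (('g \<Rightarrow> complex) \<Rightarrow> 'g) \<Rightarrow> ('g, 'g) tensor"
  where "standard_r H r \<alpha> e f = (1/2) *\<^sub>C (\<Sum>\<beta>\<in>pos_roots H \<alpha> {1..r}. wedge (e \<beta>) (f \<beta>))"

text \<open>\<open>\<delta>(a) = [a \<otimes> 1 + 1 \<otimes> a, r\<^sub>0]\<close>\<close>

definition cobracket :: "('g::complex_lie_algebra, 'g) tensor \<Rightarrow> 'g \<Rightarrow> ('g, 'g) tensor"
  where "cobracket \<tau> a = tensor_lift (\<lambda>x y. \<^bold>[a, x\<^bold>] \<otimes> y + x \<otimes> \<^bold>[a, y\<^bold>]) \<tau>"

definition rho ::
    "'g::complex_lie_algebra set \<Rightarrow> nat \<Rightarrow> (nat \<Rightarrow> 'g \<Rightarrow> complex) \<Rightarrow> nat set \<Rightarrow>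
      (('g \<Rightarrow> complex) \<Rightarrow> 'g) \<Rightarrow> (('g \<Rightarrow> complex) \<Rightarrow> 'g) \<Rightarrow> (nat \<Rightarrow> complex) \<Rightarrow> ('g, 'g) tensor"
  where "rho H r \<alpha> I e f t = (1/2) *\<^sub>C (\<Sum>\<theta>\<in>relative_roots H r \<alpha> I.
    ((1 + torus_character H r \<alpha> I \<theta> t) / (1 - torus_character H r \<alpha> I \<theta> t)) *\<^sub>C
    (\<Sum>\<beta>\<in>{\<beta> \<in> outer_roots H r \<alpha> I. restrict_center H \<alpha> I \<beta> = \<theta>}. wedge (e \<beta>) (f \<beta>)))"

definition homogeneous_functions :: "'g::complex_lie_algebra set \<Rightarrow> 'g formal_function set"
  where "homogeneous_functions L = {g. \<forall>a\<in>L. right_der a g = 0}"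

definition poisson_lie_bracket ::
    "('g::complex_lie_algebra, 'g) tensor \<Rightarrow> 'g formal_function \<Rightarrow> 'g formal_function \<Rightarrow> 'g formal_function"
  where "poisson_lie_bracket r\<^sub>0 g\<^sub>1 g\<^sub>2 = right_action r\<^sub>0 g\<^sub>1 g\<^sub>2 - left_action r\<^sub>0 g\<^sub>1 g\<^sub>2"

definition reduced_bracket ::
    "('g::complex_lie_algebra, 'g) tensor \<Rightarrow> ('g, 'g) tensor \<Rightarrow>
      'g formal_function \<Rightarrow> 'g formal_function \<Rightarrow> 'g formal_function"
  where "reduced_bracket r\<^sub>0 s g\<^sub>1 g\<^sub>2 = poisson_lie_bracket r\<^sub>0 g\<^sub>1 g\<^sub>2 - right_action s g\<^sub>1 g\<^sub>2"

definition rho_bracket ::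
    "('g::complex_lie_algebra, 'g) tensor \<Rightarrow> ('g, 'g) tensor \<Rightarrow>
      'g formal_function \<Rightarrow> 'g formal_function \<Rightarrow> 'g formal_function"
  where "rho_bracket r\<^sub>0 \<rho> g\<^sub>1 g\<^sub>2 = - (left_action r\<^sub>0 g\<^sub>1 g\<^sub>2 + right_action \<rho> g\<^sub>1 g\<^sub>2)"

section \<open>Algebraic Poisson-Lie groups\<close>

text \<open>
  An affine algebraic group over \<open>\<complex>\<close> is given as a Zariski closed subgroup of some \<open>GL\<^sub>N(\<complex>)\<close>.
  Its regular functions are restrictions of \<open>p / det\<^sup>k\<close>, extended by zero outside the group.
\<close>

inductive matrix_polynomial :: "(complex^'n^'n \<Rightarrow> complex) \<Rightarrow> bool"
  where
    "matrix_polynomial (\<lambda>_. c)"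
  | "matrix_polynomial (\<lambda>A. A $ i $ j)"
  | "matrix_polynomial p \<Longrightarrow> matrix_polynomial q \<Longrightarrow> matrix_polynomial (\<lambda>A. p A + q A)"
  | "matrix_polynomial p \<Longrightarrow> matrix_polynomial q \<Longrightarrow> matrix_polynomial (\<lambda>A. p A * q A)"

definition algebraic_group :: "(complex^'n^'n) set \<Rightarrow> bool"
  where "algebraic_group G \<longleftrightarrow>
    (\<forall>A\<in>G. invertible A) \<and> mat 1 \<in> G \<and> (\<forall>A\<in>G. \<forall>B\<in>G. A ** B \<in> G) \<and> (\<forall>A\<in>G. matrix_inv A \<in> G) \<and>
    (\<forall>A. invertible A \<and> (\<forall>p. matrix_polynomial p \<and> (\<forall>B\<in>G. p B = 0) \<longrightarrow> p A = 0) \<longrightarrow> A \<in> G)"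

definition regular_functions :: "(complex^'n^'n) set \<Rightarrow> (complex^'n^'n \<Rightarrow> complex) set"
  where "regular_functions G =
    {\<lambda>A. if A \<in> G then p A / det A ^ k else 0 | p k. matrix_polynomial p}"

definition matrix_scale :: "complex \<Rightarrow> complex^'n^'n \<Rightarrow> complex^'n^'n"
  where "matrix_scale c A = (\<chi> i j. c * A $ i $ j)"

definition matrix_exp :: "complex^'n^'n \<Rightarrow> complex^'n^'n"
  where "matrix_exp A = (\<chi> i j. suminf (\<lambda>k. ((**) A ^^ k) (mat 1) $ i $ j / fact k))"

definition matrix_lie_algebra :: "(complex^'n^'n) set \<Rightarrow> (complex^'n^'n) set"
  where "matrix_lie_algebra G = {X. \<forall>c. matrix_exp (matrix_scale c X) \<in> G}"

definition algebraic_torus :: "(complex^'n^'n) set \<Rightarrow> bool"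
  where "algebraic_torus T \<longleftrightarrow> algebraic_group T \<and> connected T \<and>
    (\<exists>P :: complex^'n^'n. invertible P \<and> (\<forall>A\<in>T. \<forall>i j. i \<noteq> j \<longrightarrow> (matrix_inv P ** A ** P) $ i $ j = 0))"

text \<open>
  The bracket on the dual of the Lie bialgebra \<open>(L, \<delta>)\<close>: \<open>[\<phi>, \<psi>] = (\<phi> \<otimes> \<psi>) \<circ> \<delta>\<close>.  As \<open>\<delta>\<close> takes values
  in the tensor square of the ambient algebra, \<open>\<phi>\<close> and \<open>\<psi>\<close> are first extended linearly from \<open>L\<close>;
  for \<open>\<delta>(L) \<subseteq> L \<otimes> L\<close> the extension does not matter.
\<close>

definition extend_form :: "'v::complex_vector set \<Rightarrow> ('v \<Rightarrow> complex) \<Rightarrow> 'v \<Rightarrow> complex"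
  where "extend_form V \<phi> = (SOME F. clinear F \<and> (\<forall>x\<in>V. F x = \<phi> x))"

definition dual_bracket ::
    "'g::complex_lie_algebra set \<Rightarrow> ('g \<Rightarrow> ('g, 'g) tensor) \<Rightarrow> ('g \<Rightarrow> complex) \<Rightarrow> ('g \<Rightarrow> complex) \<Rightarrow> 'g \<Rightarrow> complex"
  where "dual_bracket L \<delta> \<phi> \<psi> = (\<lambda>a. if a \<in> L
    then tensor_lift (\<lambda>x y. extend_form L \<phi> x * extend_form L \<psi> y) (\<delta> a) else 0)"

text \<open>
  An algebraic Poisson-Lie group \<open>G\<close> whose Lie bialgebra is the dual of \<open>(L, \<delta>)\<close>: \<open>\<iota>\<close> identifies
  \<open>L\<^sup>*\<close> with the Lie algebra of \<open>G\<close>, and \<open>pb\<close> is the Poisson bracket on the regular functions.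
  In \<open>linearization\<close>, \<open>x\<close> and \<open>y\<close> are the differentials at the identity of \<open>g\<^sub>1\<close> and \<open>g\<^sub>2\<close>, seen as
  elements of \<open>L = L\<^sup>*\<^sup>*\<close>.
\<close>

locale dual_poisson_lie_group =
  fixes L :: "'g::complex_lie_algebra set"
    and \<delta> :: "'g \<Rightarrow> ('g, 'g) tensor"
    and G :: "(complex^'n^'n) set"
    and \<iota> :: "('g \<Rightarrow> complex) \<Rightarrow> complex^'n^'n"
    and pb :: "(complex^'n^'n \<Rightarrow> complex) \<Rightarrow> (complex^'n^'n \<Rightarrow> complex) \<Rightarrow> (complex^'n^'n \<Rightarrow> complex)"
  assumes algebraic: "algebraic_group G"
    and \<iota>_bij: "bij_betw \<iota> (dual_on L) (matrix_lie_algebra G)"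
    and \<iota>_add: "\<phi> \<in> dual_on L \<Longrightarrow> \<psi> \<in> dual_on L \<Longrightarrow> \<iota> (\<lambda>x. \<phi> x + \<psi> x) = \<iota> \<phi> + \<iota> \<psi>"
    and \<iota>_scale: "\<phi> \<in> dual_on L \<Longrightarrow> \<iota> (\<lambda>x. c * \<phi> x) = matrix_scale c (\<iota> \<phi>)"
    and \<iota>_bracket: "\<phi> \<in> dual_on L \<Longrightarrow> \<psi> \<in> dual_on L \<Longrightarrow>
          \<iota> (dual_bracket L \<delta> \<phi> \<psi>) = \<iota> \<phi> ** \<iota> \<psi> - \<iota> \<psi> ** \<iota> \<phi>"
    and pb_regular: "g\<^sub>1 \<in> regular_functions G \<Longrightarrow> g\<^sub>2 \<in> regular_functions G \<Longrightarrow> pb g\<^sub>1 g\<^sub>2 \<in> regular_functions G"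
    and pb_antisym: "g\<^sub>1 \<in> regular_functions G \<Longrightarrow> g\<^sub>2 \<in> regular_functions G \<Longrightarrow>
          pb g\<^sub>1 g\<^sub>2 A = - pb g\<^sub>2 g\<^sub>1 A"
    and pb_linear: "g\<^sub>1 \<in> regular_functions G \<Longrightarrow> g\<^sub>2 \<in> regular_functions G \<Longrightarrow> g\<^sub>3 \<in> regular_functions G \<Longrightarrow>
          pb (\<lambda>B. c * g\<^sub>1 B + g\<^sub>2 B) g\<^sub>3 A = c * pb g\<^sub>1 g\<^sub>3 A + pb g\<^sub>2 g\<^sub>3 A"
    and pb_leibniz: "g\<^sub>1 \<in> regular_functions G \<Longrightarrow> g\<^sub>2 \<in> regular_functions G \<Longrightarrow> g\<^sub>3 \<in> regular_functions G \<Longrightarrow>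
          pb (\<lambda>B. g\<^sub>1 B * g\<^sub>2 B) g\<^sub>3 A = g\<^sub>1 A * pb g\<^sub>2 g\<^sub>3 A + pb g\<^sub>1 g\<^sub>3 A * g\<^sub>2 A"
    and pb_jacobi: "g\<^sub>1 \<in> regular_functions G \<Longrightarrow> g\<^sub>2 \<in> regular_functions G \<Longrightarrow> g\<^sub>3 \<in> regular_functions G \<Longrightarrow>
          pb g\<^sub>1 (pb g\<^sub>2 g\<^sub>3) A + pb g\<^sub>2 (pb g\<^sub>3 g\<^sub>1) A + pb g\<^sub>3 (pb g\<^sub>1 g\<^sub>2) A = 0"
    and multiplicative: "g\<^sub>1 \<in> regular_functions G \<Longrightarrow> g\<^sub>2 \<in> regular_functions G \<Longrightarrow> A \<in> G \<Longrightarrow> B \<in> G \<Longrightarrow>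
          pb g\<^sub>1 g\<^sub>2 (A ** B) = pb (\<lambda>X. g\<^sub>1 (X ** B)) (\<lambda>X. g\<^sub>2 (X ** B)) A
                         + pb (\<lambda>X. g\<^sub>1 (A ** X)) (\<lambda>X. g\<^sub>2 (A ** X)) B"
    and linearization: "g\<^sub>1 \<in> regular_functions G \<Longrightarrow> g\<^sub>2 \<in> regular_functions G \<Longrightarrow> x \<in> L \<Longrightarrow> y \<in> L \<Longrightarrow>
          (\<And>\<phi>. \<phi> \<in> dual_on L \<Longrightarrow> ((\<lambda>c. g\<^sub>1 (matrix_exp (matrix_scale c (\<iota> \<phi>)))) has_field_derivative \<phi> x) (at 0)) \<Longrightarrow>
          (\<And>\<phi>. \<phi> \<in> dual_on L \<Longrightarrow> ((\<lambda>c. g\<^sub>2 (matrix_exp (matrix_scale c (\<iota> \<phi>)))) has_field_derivative \<phi> y) (at 0)) \<Longrightarrow>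
          \<psi> \<in> dual_on L \<Longrightarrow>
          ((\<lambda>c. pb g\<^sub>1 g\<^sub>2 (matrix_exp (matrix_scale c (\<iota> \<psi>)))) has_field_derivative \<psi> \<^bold>[x, y\<^bold>]) (at 0)"

text \<open>\<open>h\<^sup>* \<subseteq> l\<^sup>*\<close>: forms on \<open>h\<close> are extended by zero on the root spaces of \<open>l\<close>.\<close>

definition cartan_form_extension ::
    "'g::complex_lie_algebra set \<Rightarrow> (nat \<Rightarrow> 'g \<Rightarrow> complex) \<Rightarrow> nat set \<Rightarrow> ('g \<Rightarrow> complex) \<Rightarrow> 'g \<Rightarrow> complex"
  where "cartan_form_extension H \<alpha> I \<xi> = (THE \<phi>. \<phi> \<in> dual_on (levi H \<alpha> I) \<and> (\<forall>x\<in>H. \<phi> x = \<xi> x) \<and>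
    (\<forall>\<beta>\<in>pos_roots H \<alpha> I. \<forall>x \<in> root_space H \<beta> \<union> root_space H (- \<beta>). \<phi> x = 0))"

text \<open>The value at \<open>e\<^sup>\<xi>\<close>, \<open>\<xi> \<in> h\<^sup>*\<close>, of the Poisson-Lie dynamical \<open>r\<close>-matrix.\<close>

definition dynamical_r_on_torus ::
    "'g::complex_lie_algebra set \<Rightarrow> nat \<Rightarrow> (nat \<Rightarrow> 'g \<Rightarrow> complex) \<Rightarrow> nat set \<Rightarrow>
      (('g \<Rightarrow> complex) \<Rightarrow> 'g) \<Rightarrow> (('g \<Rightarrow> complex) \<Rightarrow> 'g) \<Rightarrow> ('g \<Rightarrow> complex) \<Rightarrow> ('g, 'g) tensor"
  where "dynamical_r_on_torus H r \<alpha> I e f \<xi> =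
    (\<Sum>\<beta>\<in>outer_roots H r \<alpha> I. (1 / (1 - exp (- dual_form H \<xi> \<beta>))) *\<^sub>C wedge (e \<beta>) (f \<beta>))"

end

theory Submission
  imports Defs
begin

text \<open>
  Elements \<open>x \<and> y\<close> with \<open>x, y \<in> l\<close> act by zero on \<open>\<complex>[[G/L]]\<close>, so only the outer roots contribute, and
  there \<open>1/2 - 1/(1 - q) + (1/2)(1 + q)/(1 - q) = 0\<close> for \<open>q = e\<^bsup>-(\<chi>,\<beta>)\<^esup>\<close>.  It remains to see that
  \<open>q\<close> is the value at \<open>t\<close> of the torus character of \<open>\<theta>\<close>, the restriction of \<open>\<beta>\<close> to the center:
  the coefficients of \<open>\<theta>\<close> are well defined because the center of \<open>l\<close> is the joint kernel in \<open>h\<close> of the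
  \<open>\<alpha>\<^sub>i\<close>, \<open>i \<in> I\<close>, and \<open>(\<chi>, \<alpha>\<^sub>i) = \<chi>([e\<^sub>i, f\<^sub>i]) = 0\<close> for \<open>i \<in> I\<close>.

  Nondegeneracy of the Killing form on \<open>h\<close> needs no Cartan criterion: pairing \<open>h\<close> with
  \<open>[e\<^sub>s, f\<^sub>s]\<close> gives \<open>\<alpha>\<^sub>s(h)\<close>, and an element killed by all \<open>\<alpha>\<^sub>s\<close> is central.
\<close>

section \<open>Linear algebra\<close>

text \<open>Induction on the number of eigenvalues: \<open>T - \<mu>\<close> preserves
  \<open>W\<close>, kills the component at \<open>\<mu>\<close> and multiplies every other one by
  \<open>c - \<mu>\<close>, which is nonzero. Indexing components by their eigenvalues builds in
  that the eigenvalues are distinct.\<close>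

lemma eigencomponent_in_invariant_subspace:
  assumes T: "clinear T" and W: "complex_vector.subspace W" "\<And>x. x \<in> W \<Longrightarrow> T x \<in> W"
    and "finite F" "\<And>c. T (y c) = c *\<^sub>C y c" "sum y F \<in> W" "c \<in> F"
  shows "y c \<in> W"
  using assms(4-)
proof (induction F arbitrary: y c rule: finite_induct)
  case empty
  then show ?case by simp
next
  case (insert \<mu> F)
  have "T (sum y (insert \<mu> F)) - \<mu> *\<^sub>C sum y (insert \<mu> F) = (\<Sum>c\<in>F. (c - \<mu>) *\<^sub>C y c)"
    using insert.hyps insert.prems(1)
    by (simp add: clinear_add[OF T] clinear_sum[OF T] scaleC_add_right complex_vector.scale_sum_right
        complex_vector.scale_left_diff_distrib sum_subtractf)
  moreover have "T (sum y (insert \<mu> F)) - \<mu> *\<^sub>C sum y (insert \<mu> F) \<in> W"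
    using W insert.prems(2) by (intro complex_vector.subspace_diff complex_vector.subspace_scale)
  ultimately have "(\<Sum>c\<in>F. (c - \<mu>) *\<^sub>C y c) \<in> W" by simp
  \<comment> \<open>The rescaled vectors are again eigenvectors for the same eigenvalues, so the
    induction hypothesis applies to them in place of \<open>y\<close>.\<close>
  moreover have "T ((c - \<mu>) *\<^sub>C y c) = c *\<^sub>C (c - \<mu>) *\<^sub>C y c" for c
    by (simp add: clinear_scale[OF T] insert.prems(1) scaleC_scaleC mult.commute)
  ultimately have sc: "(c - \<mu>) *\<^sub>C y c \<in> W" if "c \<in> F" for c
    using insert.IH[of "\<lambda>c. (c - \<mu>) *\<^sub>C y c" c] that by blast
  have F: "y c \<in> W" if "c \<in> F" for c
  proof -
    have "c - \<mu> \<noteq> 0" using that insert.hyps by auto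
    then show ?thesis
      using complex_vector.subspace_scale[OF W(1) sc[OF that], of "1 / (c - \<mu>)"]
      by (simp add: scaleC_scaleC scaleC_one)
  qed
  have "y \<mu> = sum y (insert \<mu> F) - sum y F" using insert.hyps by simp
  then have "y \<mu> \<in> W"
    using complex_vector.subspace_diff[OF W(1) insert.prems(2) complex_vector.subspace_sum[OF W(1), of F y]] F
    by simp
  with F insert.prems(3) show ?case by auto
qed

lemma span_eigenvectors_decompose:
  assumes T: "clinear T" and "x \<in> cspan {x. \<exists>c. T x = c *\<^sub>C x}"
  obtains F y where "finite F" "\<And>c. T (y c) = c *\<^sub>C y c" "x = sum y F"
proof -
  \<comment> \<open>The induction also carries that \<open>y\<close> vanishes off \<open>F\<close>:
    then \<open>\<mu>\<close> can be added to \<open>F\<close> without changing the sum, whether or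
    not it was there.\<close>
  have "\<exists>F y. finite F \<and> (\<forall>c. T (y c) = c *\<^sub>C y c) \<and> (\<forall>c. c \<notin> F \<longrightarrow> y c = 0) \<and> x = sum y F"
    using assms(2)
  proof (induction rule: complex_vector.span_induct_alt)
    case base
    show ?case by (rule exI[of _ "{}"], rule exI[of _ "\<lambda>_. 0"]) (simp add: clinear_0[OF T])
  next
    case (step a v x)
    then obtain \<mu> F y where v: "T v = \<mu> *\<^sub>C v" and y: "finite F" "\<And>c. T (y c) = c *\<^sub>C y c"
      "\<And>c. c \<notin> F \<Longrightarrow> y c = 0" "x = sum y F" by blast
    let ?y = "\<lambda>c. (if c = \<mu> then a *\<^sub>C v else 0) + y c"
    have "sum y (insert \<mu> F) = sum y F"
      using y(1,3) by (cases "\<mu> \<in> F") (simp_all add: insert_absorb)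
    then have "a *\<^sub>C v + x = sum ?y (insert \<mu> F)"
      using y(1,4) by (simp add: sum.distrib sum.delta)
    moreover have "T (?y c) = c *\<^sub>C ?y c" for c
      by (cases "c = \<mu>")
        (simp_all add: clinear_add[OF T] clinear_scale[OF T] v y(2) scaleC_add_right scaleC_scaleC mult.commute)
    ultimately show ?case using y(1,3) by (intro exI[of _ "insert \<mu> F"] exI[of _ ?y]) auto
  qed
  with that show thesis by blast
qed

text \<open>Serves to diagonalize commuting operators one after another: a joint eigenspace of the
  earlier ones is an invariant subspace for the next.\<close>

lemma invariant_subspace_span_eigenvectors:
  assumes T: "clinear T" and diag: "cspan {x. \<exists>c. T x = c *\<^sub>C x} = UNIV"
    and W: "complex_vector.subspace W" "\<And>x. x \<in> W \<Longrightarrow> T x \<in> W" and x: "x \<in> W"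
  shows "x \<in> cspan {x \<in> W. \<exists>c. T x = c *\<^sub>C x}"
proof -
  obtain F y where y: "finite F" "\<And>c. T (y c) = c *\<^sub>C y c" "x = sum y F"
    using span_eigenvectors_decompose[OF T, of x] diag by auto
  have "y c \<in> {x \<in> W. \<exists>c. T x = c *\<^sub>C x}" if "c \<in> F" for c
    using eigencomponent_in_invariant_subspace[OF T W y(1,2)] that x y(2,3) by blast
  then show ?thesis
    unfolding y(3) by (intro complex_vector.span_sum complex_vector.span_base)
qed

section \<open>Linear forms on a subspace and dual bases\<close>

lemma dual_on_add: "\<phi> \<in> dual_on V \<Longrightarrow> x \<in> V \<Longrightarrow> y \<in> V \<Longrightarrow> \<phi> (x + y) = \<phi> x + \<phi> y"
  and dual_on_scale: "\<phi> \<in> dual_on V \<Longrightarrow> x \<in> V \<Longrightarrow> \<phi> (c *\<^sub>C x) = c * \<phi> x"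
  and dual_on_outside: "\<phi> \<in> dual_on V \<Longrightarrow> x \<notin> V \<Longrightarrow> \<phi> x = 0"
  by (simp_all add: dual_on_def)

lemma dual_on_diff:
  assumes "\<phi> \<in> dual_on V" "complex_vector.subspace V" "x \<in> V" "y \<in> V"
  shows "\<phi> (x - y) = \<phi> x - \<phi> y"
  using dual_on_add[OF assms(1), of "x - y" y] assms complex_vector.subspace_diff[of V x y] by simp

lemma dual_on_sum:
  assumes "\<phi> \<in> dual_on V" "complex_vector.subspace V" "\<And>i. i \<in> A \<Longrightarrow> g i \<in> V"
  shows "\<phi> (sum g A) = (\<Sum>i\<in>A. \<phi> (g i))"
  using assms(3)
proof (induction A rule: infinite_finite_induct)
  case (insert i A)
  then show ?case
    by (simp add: dual_on_add[OF assms(1)] complex_vector.subspace_sum[OF assms(2)])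
qed (use dual_on_scale[OF assms(1) complex_vector.subspace_0[OF assms(2)], of 0] in simp_all)

text \<open>Induction on \<open>S\<close>. Independence yields a vector killed by all
  \<open>\<phi> s\<close> with \<open>s \<in> S\<close> but not by \<open>\<phi> a\<close>;
  normalized, it is the new dual vector, and subtracting multiples of it corrects the old
  ones.\<close>

lemma dual_basis_exists:
  assumes V: "complex_vector.subspace V" and "finite S" "\<And>s. s \<in> S \<Longrightarrow> \<phi> s \<in> dual_on V"
    and "\<And>c. (\<And>x. (\<Sum>s\<in>S. c s * \<phi> s x) = 0) \<Longrightarrow> \<forall>s\<in>S. c s = 0"
  shows "\<exists>v. (\<forall>s\<in>S. v s \<in> V) \<and> (\<forall>s\<in>S. \<forall>s'\<in>S. \<phi> s (v s') = (if s = s' then 1 else 0))"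
  using assms(2-)
proof (induction S rule: finite_induct)
  case empty
  show ?case by simp
next
  case (insert a S)
  note dual = insert.prems(1)
  have "\<forall>s\<in>S. c s = 0" if "\<And>x. (\<Sum>s\<in>S. c s * \<phi> s x) = 0" for c
  proof -
    have "(\<Sum>s\<in>insert a S. (c(a := 0)) s * \<phi> s x) = (\<Sum>s\<in>S. c s * \<phi> s x)" for x
      using insert.hyps by (auto intro!: sum.cong)
    then have "\<forall>s\<in>insert a S. (c(a := 0)) s = 0" using insert.prems(2)[of "c(a := 0)"] that by simp
    then show ?thesis using insert.hyps(2) by (metis fun_upd_other insertCI)
  qed
  with insert.IH dual obtain v where v: "\<And>s. s \<in> S \<Longrightarrow> v s \<in> V"
    "\<And>s s'. s \<in> S \<Longrightarrow> s' \<in> S \<Longrightarrow> \<phi> s (v s') = (if s = s' then 1 else 0)" by blast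
  have "\<exists>u\<in>V. (\<forall>s\<in>S. \<phi> s u = 0) \<and> \<phi> a u \<noteq> 0"
  proof (rule ccontr)
    assume none: "\<not> ?thesis"
    have comb: "\<phi> a x = (\<Sum>s\<in>S. \<phi> a (v s) * \<phi> s x)" for x
    proof (cases "x \<in> V")
      case True
      \<comment> \<open>\<open>?w\<close> has the same values as \<open>x\<close> under the forms of
        \<open>S\<close>, so \<open>none\<close> forces \<open>\<phi> a\<close> to agree on both as
        well.\<close>
      let ?w = "\<Sum>s\<in>S. \<phi> s x *\<^sub>C v s"
      have mem: "\<phi> s x *\<^sub>C v s \<in> V" if "s \<in> S" for s
        using that v(1) V by (simp add: complex_vector.subspace_scale)
      then have w: "?w \<in> V" by (simp add: complex_vector.subspace_sum[OF V])
      have val: "\<phi> i ?w = (\<Sum>s\<in>S. \<phi> s x * \<phi> i (v s))" if "i \<in> insert a S" for i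
        by (subst dual_on_sum[OF dual[OF that] V]; simp add: mem dual_on_scale[OF dual[OF that]] v(1))
      have "\<phi> i ?w = \<phi> i x" if "i \<in> S" for i
      proof -
        have "(\<Sum>s\<in>S. \<phi> s x * \<phi> i (v s)) = (\<Sum>s\<in>S. if i = s then \<phi> s x else 0)"
          using v(2)[OF that] by (intro sum.cong) auto
        with that insert.hyps show ?thesis by (simp add: val)
      qed
      then have "\<forall>i\<in>S. \<phi> i (x - ?w) = 0"
        using dual_on_diff[OF dual V True w] by simp
      with none have "\<phi> a (x - ?w) = 0"
        using complex_vector.subspace_diff[OF V True w] by blast
      then show ?thesis
        using dual_on_diff[OF dual[of a] V True w] val[of a] by (simp add: mult.commute)
    next
      \<comment> \<open>Independence concerns functions on the whole space, so points outside
        \<open>V\<close> count too; there all forms are zero by convention.\<close>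
      case False
      have "\<phi> s x = 0" if "s \<in> insert a S" for s using dual_on_outside[OF dual[OF that] False] .
      then show ?thesis by simp
    qed
    \<comment> \<open>The relation \<open>comb\<close> is a linear dependence whose coefficient at
      \<open>a\<close> is 1, against independence.\<close>
    let ?c = "(\<lambda>s. - \<phi> a (v s))(a := 1)"
    have "(\<Sum>s\<in>insert a S. ?c s * \<phi> s x) = 0" for x
    proof -
      have "(\<Sum>s\<in>S. ?c s * \<phi> s x) = (\<Sum>s\<in>S. - \<phi> a (v s) * \<phi> s x)"
        using insert.hyps by (intro sum.cong) auto
      then show ?thesis using insert.hyps comb[of x] by (simp add: sum_negf)
    qed
    from insert.prems(2)[OF this] show False by simp
  qed
  then obtain u where u: "u \<in> V" "\<And>s. s \<in> S \<Longrightarrow> \<phi> s u = 0" "\<phi> a u \<noteq> 0" by blast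
  have "(1 / \<phi> a u) *\<^sub>C u \<in> V" "\<And>s. s \<in> S \<Longrightarrow> \<phi> s ((1 / \<phi> a u) *\<^sub>C u) = 0"
    "\<phi> a ((1 / \<phi> a u) *\<^sub>C u) = 1"
    using u by (simp_all add: complex_vector.subspace_scale[OF V] dual_on_scale[OF dual u(1)])
  then obtain w where w: "w \<in> V" "\<And>s. s \<in> S \<Longrightarrow> \<phi> s w = 0" "\<phi> a w = 1" by blast
  let ?v = "\<lambda>s. if s = a then w else v s - \<phi> a (v s) *\<^sub>C w"
  have V': "\<phi> a (v s) *\<^sub>C w \<in> V" for s by (rule complex_vector.subspace_scale[OF V w(1)])
  have "\<forall>s\<in>insert a S. ?v s \<in> V"
    using w v(1) V' by (simp add: complex_vector.subspace_diff[OF V])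
  moreover have "\<phi> i (v s - \<phi> a (v s) *\<^sub>C w) = \<phi> i (v s) - \<phi> a (v s) * \<phi> i w"
    if "i \<in> insert a S" "s \<in> S" for i s
    by (rule trans[OF dual_on_diff[OF dual[OF that(1)] V v(1)[OF that(2)] V']])
       (simp only: dual_on_scale[OF dual[OF that(1)] w(1)])
  then have "\<forall>i\<in>insert a S. \<forall>s\<in>insert a S. \<phi> i (?v s) = (if i = s then 1 else 0)"
    using w v(2) insert.hyps by auto
  ultimately show ?case by (intro exI[of _ ?v] conjI)
qed

section \<open>Traces in finite dimension\<close>

locale finite_dimensional =
  fixes ty :: "'v::complex_vector itself"
  assumes finite_spanning: "\<exists>B :: 'v set. finite B \<and> cspan B = UNIV"
begin

lemma finite_independent: "complex_vector.independent (S :: 'v set) \<Longrightarrow> finite S"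
  using finite_spanning complex_vector.independent_span_bound by blast

text \<open>The very basis over which \<open>endo_trace\<close> is defined, so that traces are
  directly sums of coordinates.\<close>

definition basis :: "'v set" where "basis = complex_vector.extend_basis {}"

lemma basis: "complex_vector.independent basis" "cspan basis = UNIV" "finite basis"
proof -
  have "complex_vector.independent ({} :: 'v set)" by (rule complex_vector.independent_empty)
  then show "complex_vector.independent basis" "cspan basis = UNIV"
    unfolding basis_def
    using complex_vector.independent_extend_basis complex_vector.span_extend_basis by blast+
  then show "finite basis" by (simp add: finite_independent)
qed

definition coord :: "'v \<Rightarrow> 'v \<Rightarrow> complex" where "coord = complex_vector.representation basis"

lemma clinear_coord: "clinear (\<lambda>x. coord x b)"
  using basis unfolding clinear_iff coord_def
  by (simp add: complex_vector.representation_add complex_vector.representation_scale scaleC_complex_def)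

lemma coord_expand: "(\<Sum>b\<in>basis. coord x b *\<^sub>C b) = x"
  using basis unfolding coord_def
  by (intro complex_vector.sum_representation_eq) simp_all

lemma endo_trace_coord: "endo_trace F = (\<Sum>b\<in>basis. coord (F b) b)"
  by (simp add: endo_trace_def coord_def basis_def)

lemma endo_trace_add: "endo_trace (\<lambda>x. F x + G x) = endo_trace F + endo_trace (G :: 'v \<Rightarrow> 'v)"
  by (simp add: endo_trace_coord clinear_add[OF clinear_coord] sum.distrib)

lemma endo_trace_diff: "endo_trace (\<lambda>x. F x - G x) = endo_trace F - endo_trace (G :: 'v \<Rightarrow> 'v)"
  by (simp add: endo_trace_coord clinear_diff[OF clinear_coord] sum_subtractf)

lemma endo_trace_scale: "endo_trace (\<lambda>x. c *\<^sub>C F x) = c * endo_trace (F :: 'v \<Rightarrow> 'v)"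
  by (simp add: endo_trace_coord clinear_scale[OF clinear_coord] sum_distrib_left scaleC_complex_def)

text \<open>The diagonal of a matrix product, in a form where exchanging the two sums exchanges
  \<open>F\<close> and \<open>G\<close>.\<close>

lemma endo_trace_compose:
  fixes F G :: "'v \<Rightarrow> 'v"
  assumes F: "clinear F"
  shows "endo_trace (\<lambda>x. F (G x)) = (\<Sum>b\<in>basis. \<Sum>c\<in>basis. coord (G b) c * coord (F c) b)"
proof -
  have "F (G b) = (\<Sum>c\<in>basis. coord (G b) c *\<^sub>C F c)" for b
    by (subst coord_expand[of "G b", symmetric]) (simp add: clinear_sum[OF F] clinear_scale[OF F])
  then show ?thesis
    by (simp add: endo_trace_coord clinear_sum[OF clinear_coord] clinear_scale[OF clinear_coord] scaleC_complex_def)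
qed

lemma endo_trace_commute:
  fixes F G :: "'v \<Rightarrow> 'v"
  assumes "clinear F" "clinear G"
  shows "endo_trace (\<lambda>x. F (G x)) = endo_trace (\<lambda>x. G (F x))"
  unfolding endo_trace_compose[OF assms(1)] endo_trace_compose[OF assms(2)]
  by (subst sum.swap) (simp add: mult.commute)

end

section \<open>Actions on formal functions\<close>

lemma cbilinear_times_formal_function:
  "cbilinear (\<lambda>f g :: 'g::complex_lie_algebra formal_function. f * g)"
proof -
  let ?m = "\<lambda>(a :: 'g uea \<Rightarrow> complex) (b :: 'g uea \<Rightarrow> complex). tensor_lift (\<lambda>v w. a v * b w)"
  have b: "cbilinear (\<lambda>v w. a v * b w)" if "clinear a" "clinear b" for a b :: "'g uea \<Rightarrow> complex"
    using that by (simp add: cbilinear_def clinear_iff algebra_simps scaleC_complex_def)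
  \<comment> \<open>Linear maps on a tensor product agree once they agree on pure tensors; this
    turns pointwise identities between bilinear maps into identities between their lifts.\<close>
  have eq: "tensor_lift k t = tensor_lift k1 t + tensor_lift k2 t"
    if "cbilinear k" "cbilinear k1" "cbilinear k2" "\<And>x y. k x y = k1 x y + k2 x y"
    for k k1 k2 :: "'g uea \<Rightarrow> 'g uea \<Rightarrow> complex" and t
    by (rule tensor_eqI[of "tensor_lift k" "\<lambda>t. tensor_lift k1 t + tensor_lift k2 t" t,
        OF clinear_tensor_lift clinear_plus[OF clinear_tensor_lift clinear_tensor_lift]]) (simp_all add: that)
  have sc: "tensor_lift k t = c *\<^sub>C tensor_lift k1 t"
    if "cbilinear k" "cbilinear k1" "\<And>x y. k x y = c *\<^sub>C k1 x y"
    for k k1 :: "'g uea \<Rightarrow> 'g uea \<Rightarrow> complex" and t c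
    by (rule tensor_eqI[of "tensor_lift k" "\<lambda>t. c *\<^sub>C tensor_lift k1 t" t,
        OF clinear_tensor_lift clinear_scaleC[OF clinear_tensor_lift]]) (simp_all add: that)
  have add_right: "?m a (\<lambda>u. b u + b' u) t = ?m a b t + ?m a b' t"
    and add_left: "?m (\<lambda>u. b u + b' u) a t = ?m b a t + ?m b' a t"
    if "clinear a" "clinear b" "clinear b'" for a b b' t
    by (rule eq; (intro b clinear_plus that)?; simp add: distrib_left distrib_right)+
  have scale_right: "?m a (\<lambda>u. c *\<^sub>C b u) t = c *\<^sub>C ?m a b t" if "clinear a" "clinear b" for a b :: "'g uea \<Rightarrow> complex" and c t
  proof (rule sc)
    show "cbilinear (\<lambda>v w. a v * (c *\<^sub>C b w))" by (intro b clinear_scaleC that)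
  qed (simp_all add: b that scaleC_complex_def)
  have scale_left: "?m (\<lambda>u. c *\<^sub>C a u) b t = c *\<^sub>C ?m a b t" if "clinear a" "clinear b" for a b :: "'g uea \<Rightarrow> complex" and c t
  proof (rule sc)
    show "cbilinear (\<lambda>v w. (c *\<^sub>C a v) * b w)" by (intro b clinear_scaleC that)
  qed (simp_all add: b that scaleC_complex_def)
  have "f * (g + h) = f * g + f * h" "(g + h) * f = g * f + h * f" for f g h :: "'g formal_function"
    by (transfer, simp add: add_right add_left)+
  moreover have "f * (c *\<^sub>C g) = c *\<^sub>C (f * g)" "(c *\<^sub>C f) * g = c *\<^sub>C (f * g)"
    for f g :: "'g formal_function" and c
    by (transfer, simp add: scale_right scale_left)+
  ultimately show ?thesis by (simp add: cbilinear_def clinear_iff)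
qed

lemma cbilinear_right_der: "cbilinear right_der"
  unfolding cbilinear_def clinear_iff
  by (intro conjI allI; transfer)
     (simp_all add: fun_eq_iff uea_of_add uea_of_scale distrib_left mult_scaleC_right clinear_add clinear_scale)

lemma cbilinear_right_action: "cbilinear (\<lambda>a b. right_der a g\<^sub>1 * right_der b g\<^sub>2)"
proof -
  have R: "clinear (\<lambda>a. right_der a g)" for g :: "'a formal_function"
    using cbilinear_right_der unfolding cbilinear_def by blast
  have m: "clinear (\<lambda>g. f * g)" "clinear (\<lambda>g. g * f)" for f :: "'a formal_function"
    using cbilinear_times_formal_function unfolding cbilinear_def by blast+
  show ?thesis
    unfolding cbilinear_def using clinear_compose[OF m(1) R] clinear_compose[OF m(2) R] by blast
qed

text \<open>Allows the action of \<open>r\<close>-matrices to be computed root by root.\<close>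

lemma clinear_right_action: "clinear (\<lambda>\<tau>. right_action \<tau> g\<^sub>1 g\<^sub>2)"
  unfolding right_action_def by (rule clinear_tensor_lift[OF cbilinear_right_action])

lemma times_formal_function_zero:
  fixes f :: "'g::complex_lie_algebra formal_function"
  shows "f * 0 = 0" "0 * f = 0"
proof -
  have "clinear (\<lambda>g. f * g)" "clinear (\<lambda>g. g * f)"
    using cbilinear_times_formal_function unfolding cbilinear_def by blast+
  then show "f * 0 = 0" "0 * f = 0" by (auto dest: clinear_0)
qed

text \<open>Right derivatives along \<open>L\<close> annihilate these functions, so each product in
  the action has a zero factor.\<close>

lemma right_action_wedge_eq_0:
  assumes "g\<^sub>1 \<in> homogeneous_functions L" "g\<^sub>2 \<in> homogeneous_functions L" "x \<in> L" "y \<in> L"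
  shows "right_action (wedge x y) g\<^sub>1 g\<^sub>2 = 0"
proof -
  have "right_action (x \<otimes> y) g\<^sub>1 g\<^sub>2 = 0" if "x \<in> L" "y \<in> L" for x y
    using that assms(1,2)
    by (simp add: right_action_def cbilinear_right_action homogeneous_functions_def times_formal_function_zero)
  then show ?thesis
    using assms(3,4) by (simp add: wedge_def clinear_diff[OF clinear_right_action])
qed

section \<open>Root decomposition and the Killing form\<close>

lemma clinear_ad: "clinear (\<lambda>y. \<^bold>[x, y\<^bold>])" "clinear (\<lambda>x. \<^bold>[x, y\<^bold>])"
  by (simp_all add: clinear_iff lie_add_left lie_add_right lie_scale_left lie_scale_right)

lemma lie_antisym: "\<^bold>[x, y\<^bold>] = - \<^bold>[y, x\<^bold>]"
proof -
  have "\<^bold>[x + y, x + y\<^bold>] = \<^bold>[x, y\<^bold>] + \<^bold>[y, x\<^bold>]"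
    unfolding lie_add_left lie_add_right by (simp add: lie_self)
  then show ?thesis by (simp add: lie_self eq_neg_iff_add_eq_0)
qed

lemma lie_bracket_derivation: "\<^bold>[x, \<^bold>[y, z\<^bold>]\<^bold>] = \<^bold>[\<^bold>[x, y\<^bold>], z\<^bold>] + \<^bold>[y, \<^bold>[x, z\<^bold>]\<^bold>]"
proof -
  have "\<^bold>[x, \<^bold>[y, z\<^bold>]\<^bold>] + \<^bold>[y, \<^bold>[z, x\<^bold>]\<^bold>] + \<^bold>[z, \<^bold>[x, y\<^bold>]\<^bold>] = 0" by (rule lie_jacobi)
  moreover have "\<^bold>[y, \<^bold>[z, x\<^bold>]\<^bold>] = - \<^bold>[y, \<^bold>[x, z\<^bold>]\<^bold>]"
    by (subst lie_antisym[of z x]) (rule clinear_uminus[OF clinear_ad(1)])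
  ultimately show ?thesis
    using lie_antisym[of z "\<^bold>[x, y\<^bold>]"] by (simp add: add_eq_0_iff algebra_simps)
qed

text \<open>Coefficients are extended by zero. The larger index set is finite because a sum over an
  infinite set is 0 by convention.\<close>

lemma pos_roots_mono:
  assumes "S \<subseteq> S'" "finite S'"
  shows "pos_roots H \<alpha> S \<subseteq> pos_roots H \<alpha> S'"
proof -
  have "nat_combination \<alpha> S n = nat_combination \<alpha> S' (\<lambda>s. if s \<in> S then n s else 0)" for n
    unfolding nat_combination_def
    by (rule ext, rule sum.mono_neutral_cong_left) (use assms in auto)
  then show ?thesis unfolding pos_roots_def by blast
qed

locale lie_algebra_with_simple_roots =
  fixes H :: "'g::complex_lie_algebra set" and r :: nat and \<alpha> :: "nat \<Rightarrow> 'g \<Rightarrow> complex"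
    and e f :: "('g \<Rightarrow> complex) \<Rightarrow> 'g"
  assumes simple: "simple_lie_algebra TYPE('g)"
    and cartan: "cartan_subalgebra H"
    and simple_roots: "simple_roots H r \<alpha>"
    and root_vectors: "root_vectors H r \<alpha> e f"
begin

sublocale finite_dimensional "TYPE('g)"
  using simple by unfold_locales (auto simp: simple_lie_algebra_def)

lemma H_subspace: "complex_vector.subspace H"
  and H_abelian: "x \<in> H \<Longrightarrow> y \<in> H \<Longrightarrow> \<^bold>[x, y\<^bold>] = 0"
  and H_maximal: "(\<And>h. h \<in> H \<Longrightarrow> \<^bold>[h, x\<^bold>] = 0) \<Longrightarrow> x \<in> H"
  and H_diagonalizable: "h \<in> H \<Longrightarrow> cspan {x. \<exists>c. \<^bold>[h, x\<^bold>] = c *\<^sub>C x} = UNIV"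
  using cartan unfolding cartan_subalgebra_def by blast+

lemma simple_root: "s \<in> {1..r} \<Longrightarrow> \<alpha> s \<in> roots H"
  and simple_roots_independent: "(\<And>x. (\<Sum>s\<in>{1..r}. c s * \<alpha> s x) = 0) \<Longrightarrow> \<forall>s\<in>{1..r}. c s = 0"
  and roots_cases: "\<beta> \<in> roots H \<Longrightarrow> \<exists>n. \<beta> = nat_combination \<alpha> {1..r} n \<or> \<beta> = - nat_combination \<alpha> {1..r} n"
  using simple_roots by (auto simp: simple_roots_def)

lemma root_dual: "\<beta> \<in> roots H \<Longrightarrow> \<beta> \<in> dual_on H"
  by (simp add: roots_def)

section \<open>Simultaneous diagonalization of the Cartan subalgebra\<close>

definition joint_eigenvectors :: "'g set \<Rightarrow> 'g set"
  where "joint_eigenvectors S = {x. \<forall>h\<in>S. \<exists>c. \<^bold>[h, x\<^bold>] = c *\<^sub>C x}"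

text \<open>Adds one operator at a time: since \<open>H\<close> is abelian, \<open>ad h\<close>
  preserves the joint eigenspaces of \<open>S\<close>, and it remains diagonalizable on each of
  them.\<close>

lemma span_joint_eigenvectors_finite:
  assumes "finite S" "S \<subseteq> H"
  shows "cspan (joint_eigenvectors S) = UNIV"
  using assms
proof (induction S rule: finite_induct)
  case empty
  then show ?case by (simp add: joint_eigenvectors_def)
next
  case (insert h S)
  have "x \<in> cspan (joint_eigenvectors (insert h S))" if "x \<in> joint_eigenvectors S" for x
  proof -
    from that obtain c where c: "\<And>k. k \<in> S \<Longrightarrow> \<^bold>[k, x\<^bold>] = c k *\<^sub>C x"
      unfolding joint_eigenvectors_def by (auto simp: bchoice_iff)
    \<comment> \<open>The joint eigenspace of \<open>S\<close> through \<open>x\<close>.\<close>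
    define W where "W = {y. \<forall>k\<in>S. \<^bold>[k, y\<^bold>] = c k *\<^sub>C y}"
    have sub: "complex_vector.subspace W"
      by (rule complex_vector.subspaceI)
         (auto simp: W_def lie_add_right lie_scale_right scaleC_add_right scaleC_scaleC mult.commute
           clinear_0[OF clinear_ad(1)])
    have "\<^bold>[h, y\<^bold>] \<in> W" if "y \<in> W" for y
    proof -
      have "\<^bold>[k, \<^bold>[h, y\<^bold>]\<^bold>] = c k *\<^sub>C \<^bold>[h, y\<^bold>]" if "k \<in> S" for k
      proof -
        have "\<^bold>[k, h\<^bold>] = 0" using insert.prems that by (intro H_abelian) auto
        then show ?thesis
          using lie_bracket_derivation[of k h y] \<open>y \<in> W\<close> that
          by (simp add: W_def lie_scale_right clinear_0[OF clinear_ad(2)])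
      qed
      then show ?thesis by (simp add: W_def)
    qed
    moreover have "cspan {x. \<exists>c. \<^bold>[h, x\<^bold>] = c *\<^sub>C x} = UNIV" using insert.prems by (intro H_diagonalizable) simp
    moreover have "x \<in> W" using c by (simp add: W_def)
    ultimately have "x \<in> cspan {x \<in> W. \<exists>c. \<^bold>[h, x\<^bold>] = c *\<^sub>C x}"
      using invariant_subspace_span_eigenvectors[OF clinear_ad(1)[of h] _ sub] by blast
    moreover have "{x \<in> W. \<exists>c. \<^bold>[h, x\<^bold>] = c *\<^sub>C x} \<subseteq> joint_eigenvectors (insert h S)"
      by (auto simp: W_def joint_eigenvectors_def)
    ultimately show ?thesis using complex_vector.span_mono by blast
  qed
  then have "cspan (joint_eigenvectors S) \<subseteq> cspan (joint_eigenvectors (insert h S))"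
    by (intro complex_vector.span_minimal complex_vector.subspace_span) blast
  with insert show ?case by auto
qed

text \<open>A finite basis of \<open>H\<close> suffices, because the \<open>h\<close> that have a
  given \<open>x\<close> as eigenvector form a subspace.\<close>

lemma span_joint_eigenvectors: "cspan (joint_eigenvectors H) = UNIV"
proof -
  obtain S where S: "S \<subseteq> H" "complex_vector.independent S" "H \<subseteq> cspan S"
    by (rule complex_vector.basis_exists[of H]) blast
  have "x \<in> joint_eigenvectors H" if "x \<in> joint_eigenvectors S" for x
  proof -
    have "complex_vector.subspace {h. \<exists>c. \<^bold>[h, x\<^bold>] = c *\<^sub>C x}"
    proof (rule complex_vector.subspaceI)
      show "0 \<in> {h. \<exists>c. \<^bold>[h, x\<^bold>] = c *\<^sub>C x}"
        by (auto simp: clinear_0[OF clinear_ad(2)] intro: exI[of _ 0])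
    qed (auto simp: lie_add_left lie_scale_left scaleC_scaleC simp flip: scaleC_add_left)
    moreover have "S \<subseteq> {h. \<exists>c. \<^bold>[h, x\<^bold>] = c *\<^sub>C x}"
      using that by (auto simp: joint_eigenvectors_def)
    ultimately have "H \<subseteq> {h. \<exists>c. \<^bold>[h, x\<^bold>] = c *\<^sub>C x}"
      using S(3) complex_vector.span_minimal by blast
    then show ?thesis by (auto simp: joint_eigenvectors_def)
  qed
  then have "cspan (joint_eigenvectors S) \<subseteq> cspan (joint_eigenvectors H)"
    by (intro complex_vector.span_mono) blast
  then show ?thesis
    using span_joint_eigenvectors_finite[OF finite_independent[OF S(2)] S(1)] by auto
qed

text \<open>The eigenvalue of a nonzero vector is unique; this uniqueness makes it depend linearly
  on \<open>h\<close>.\<close>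

lemma joint_eigenvector_weight:
  assumes "x \<in> joint_eigenvectors H" "x \<noteq> 0"
  obtains \<beta> where "\<beta> \<in> dual_on H" "\<And>h. h \<in> H \<Longrightarrow> \<^bold>[h, x\<^bold>] = \<beta> h *\<^sub>C x"
proof -
  from assms(1) obtain c where c: "\<And>h. h \<in> H \<Longrightarrow> \<^bold>[h, x\<^bold>] = c h *\<^sub>C x"
    unfolding joint_eigenvectors_def by (auto simp: bchoice_iff)
  \<comment> \<open>Zero outside \<open>H\<close>, as \<open>dual_on H\<close> demands.\<close>
  define \<beta> where "\<beta> h = (if h \<in> H then c h else 0)" for h
  have \<beta>: "\<^bold>[h, x\<^bold>] = \<beta> h *\<^sub>C x" if "h \<in> H" for h using c that by (simp add: \<beta>_def)
  have inj: "a = b" if "a *\<^sub>C x = b *\<^sub>C x" for a b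
    using that assms(2) by (simp add: complex_vector.scale_cancel_right)
  have "\<beta> \<in> dual_on H"
    unfolding dual_on_def
  proof (intro CollectI conjI ballI allI impI)
    fix h k assume "h \<in> H" "k \<in> H"
    then show "\<beta> (h + k) = \<beta> h + \<beta> k"
      using complex_vector.subspace_add[OF H_subspace] \<beta>[of "h + k"]
      by (intro inj) (simp add: lie_add_left \<beta> scaleC_add_left)
  next
    fix c h assume "h \<in> H"
    then show "\<beta> (c *\<^sub>C h) = c * \<beta> h"
      using complex_vector.subspace_scale[OF H_subspace] \<beta>[of "c *\<^sub>C h"]
      by (intro inj) (simp add: lie_scale_left \<beta> scaleC_scaleC del: complex_vector.scale_cancel_right)
  qed (simp add: \<beta>_def)
  with \<beta> that show thesis by blast
qed

text \<open>A finite basis of joint eigenvectors has finitely many weights, and every root is one of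
  them: expand a root vector in this basis and compare coefficients.\<close>

lemma finite_roots: "finite (roots H)"
proof -
  obtain B where B: "B \<subseteq> joint_eigenvectors H" "complex_vector.independent B"
      "joint_eigenvectors H \<subseteq> cspan B"
    by (rule complex_vector.basis_exists[of "joint_eigenvectors H"]) blast
  have "cspan (joint_eigenvectors H) \<subseteq> cspan B"
    by (intro complex_vector.span_minimal B(3) complex_vector.subspace_span)
  then have span: "cspan B = UNIV" by (simp add: span_joint_eigenvectors top.extremum_unique)
  have fin: "finite B" by (rule finite_independent[OF B(2)])
  have "0 \<notin> B" using B(2) complex_vector.dependent_zero by blast
  then have "\<exists>\<beta>. \<beta> \<in> dual_on H \<and> (\<forall>h\<in>H. \<^bold>[h, b\<^bold>] = \<beta> h *\<^sub>C b)" if "b \<in> B" for b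
    using that B(1) joint_eigenvector_weight[of b] by (metis subsetD)
  then obtain wt where wt: "\<And>b. b \<in> B \<Longrightarrow> wt b \<in> dual_on H"
    "\<And>b h. b \<in> B \<Longrightarrow> h \<in> H \<Longrightarrow> \<^bold>[h, b\<^bold>] = wt b h *\<^sub>C b"
    by metis
  have "roots H \<subseteq> wt ` B"
  proof
    fix \<beta> assume \<beta>: "\<beta> \<in> roots H"
    have "0 \<in> root_space H \<beta>" by (simp add: root_space_def clinear_0[OF clinear_ad(1)])
    with \<beta> obtain x where x: "x \<in> root_space H \<beta>" "x \<noteq> 0" unfolding roots_def by blast
    let ?c = "complex_vector.representation B x"
    have sum: "x = (\<Sum>b\<in>B. ?c b *\<^sub>C b)"
      using complex_vector.sum_representation_eq[OF B(2) _ fin, of x] span by simp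
    with x(2) obtain b where b: "b \<in> B" "?c b \<noteq> 0"
      by (metis (no_types, lifting) complex_vector.scale_zero_left sum.neutral)
    have "wt b h = \<beta> h" if h: "h \<in> H" for h
    proof -
      have "0 = \<^bold>[h, x\<^bold>] - \<beta> h *\<^sub>C x" using x h by (simp add: root_space_def)
      also have "\<dots> = (\<Sum>b\<in>B. ?c b *\<^sub>C wt b h *\<^sub>C b) - (\<Sum>b\<in>B. \<beta> h *\<^sub>C ?c b *\<^sub>C b)"
        using h by (subst (1 2) sum)
          (simp add: clinear_sum[OF clinear_ad(1)] lie_scale_right wt complex_vector.scale_sum_right)
      also have "\<dots> = (\<Sum>b\<in>B. (?c b * (wt b h - \<beta> h)) *\<^sub>C b)"
        by (simp add: scaleC_scaleC algebra_simps complex_vector.scale_left_diff_distrib flip: sum_subtractf)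
      finally have "(\<Sum>b\<in>B. (?c b * (wt b h - \<beta> h)) *\<^sub>C b) = 0" ..
      then have "?c b * (wt b h - \<beta> h) = 0"
        using complex_vector.independentD[OF B(2) fin, of "\<lambda>b. ?c b * (wt b h - \<beta> h)"] b(1) by blast
      with b(2) show ?thesis by simp
    qed
    \<comment> \<open>Agreement on \<open>H\<close> is enough, since both forms vanish
      elsewhere.\<close>
    then have "wt b = \<beta>"
      using wt(1)[OF b(1)] root_dual[OF \<beta>] by (metis dual_on_outside ext)
    with b(1) show "\<beta> \<in> wt ` B" by blast
  qed
  with fin show ?thesis using finite_subset by blast
qed

text \<open>All roots vanish at \<open>h\<close>, so \<open>ad h\<close> kills every joint
  eigenvector and hence everything. The center is an ideal, and it is proper because the algebra is
  not abelian; simplicity makes it zero.\<close>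

lemma simple_roots_separate:
  assumes h: "h \<in> H" and zero: "\<And>s. s \<in> {1..r} \<Longrightarrow> \<alpha> s h = 0"
  shows "h = 0"
proof -
  have comb: "nat_combination \<alpha> {1..r} n h = 0" for n
    using zero by (simp add: nat_combination_def)
  have root: "\<beta> h = 0" if "\<beta> \<in> roots H" for \<beta>
    using roots_cases[OF that] comb by (auto simp: fun_Compl_def)
  have "\<^bold>[h, x\<^bold>] = 0" if x: "x \<in> joint_eigenvectors H" for x
  proof (cases "x = 0")
    case True
    then show ?thesis by (simp add: clinear_0[OF clinear_ad(1)])
  next
    case False
    from joint_eigenvector_weight[OF x False] obtain \<beta>
      where \<beta>: "\<beta> \<in> dual_on H" "\<And>h. h \<in> H \<Longrightarrow> \<^bold>[h, x\<^bold>] = \<beta> h *\<^sub>C x" by blast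
    then have "x \<in> root_space H \<beta>" by (simp add: root_space_def)
    with False \<beta>(1) have "\<beta> = (\<lambda>_. 0) \<or> \<beta> \<in> roots H" by (auto simp: roots_def)
    then have "\<beta> h = 0" using root by auto
    with \<beta>(2)[OF h] show ?thesis by simp
  qed
  then have central: "\<^bold>[h, x\<^bold>] = 0" for x
    using clinear_vanishes_on_span[OF clinear_ad(1)] span_joint_eigenvectors by blast
  let ?Z = "{z :: 'g. \<forall>x. \<^bold>[z, x\<^bold>] = 0}"
  have "complex_vector.subspace ?Z"
    by (rule complex_vector.subspaceI) (auto simp: clinear_0[OF clinear_ad(2)] lie_add_left lie_scale_left)
  moreover have "\<^bold>[x, z\<^bold>] \<in> ?Z" if "z \<in> ?Z" for x z
    using that lie_antisym[of x z] by (simp add: clinear_0[OF clinear_ad(2)])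
  ultimately have "lie_ideal ?Z"
    unfolding lie_ideal_def by blast
  then have "?Z = {0} \<or> ?Z = UNIV" using simple by (simp add: simple_lie_algebra_def)
  moreover have "?Z \<noteq> UNIV" using simple by (auto simp: simple_lie_algebra_def)
  ultimately show ?thesis using central by blast
qed

section \<open>Symmetry and invariance of the Killing form\<close>

lemma killing_commute: "killing x y = killing y (x :: 'g)"
  unfolding killing_def by (rule endo_trace_commute) (rule clinear_ad)+

lemma clinear_killing_right: "clinear (killing (x :: 'g))"
proof -
  have "killing x (y + z) = killing x y + killing x z" for y z
    by (simp add: killing_def lie_add_left lie_add_right endo_trace_add)
  moreover have "killing x (c *\<^sub>C y) = c * killing x y" for c y
    by (simp add: killing_def lie_scale_left lie_scale_right endo_trace_scale)
  ultimately show ?thesis by (simp add: clinear_iff scaleC_complex_def)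
qed

lemma clinear_killing_left: "clinear (\<lambda>x. killing x (y :: 'g))"
  unfolding killing_commute[of _ y] by (rule clinear_killing_right)

text \<open>Expanding \<open>ad\<close> of a bracket, both sides become differences of traces of
  triple products. One trace is common; the other two differ by a cyclic rotation.\<close>

lemma killing_invariant: "killing \<^bold>[x, y\<^bold>] z = killing x \<^bold>[y, z :: 'g\<^bold>]"
proof -
  have br: "\<^bold>[\<^bold>[x, y\<^bold>], w\<^bold>] = \<^bold>[x, \<^bold>[y, w\<^bold>]\<^bold>] - \<^bold>[y, \<^bold>[x, w\<^bold>]\<^bold>]" for x y w :: 'g
    using lie_bracket_derivation[of x y w] by simp
  have "endo_trace (\<lambda>w. \<^bold>[y, \<^bold>[x, \<^bold>[z, w\<^bold>]\<^bold>]\<^bold>]) = endo_trace (\<lambda>w. \<^bold>[x, \<^bold>[z, \<^bold>[y, w\<^bold>]\<^bold>]\<^bold>])"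
    by (rule endo_trace_commute) (intro clinear_ad clinear_compose[OF clinear_ad(1)])+
  then show ?thesis
    by (simp add: killing_def br endo_trace_diff clinear_diff[OF clinear_ad(1)])
qed

lemma simple_root_pos: "S \<subseteq> {1..r} \<Longrightarrow> s \<in> S \<Longrightarrow> \<alpha> s \<in> pos_roots H \<alpha> S"
proof -
  assume s: "S \<subseteq> {1..r}" "s \<in> S"
  then have "finite S" using finite_subset by blast
  with s(2) have "\<alpha> s = nat_combination \<alpha> S (\<lambda>i. if i = s then 1 else 0)"
    by (simp add: nat_combination_def if_distrib[of of_nat] if_distrib[of "\<lambda>a. a * _"] sum.delta cong: if_cong)
  with s simple_root show ?thesis unfolding pos_roots_def by blast
qed

lemma root_vectorsD:
  assumes "\<beta> \<in> pos_roots H \<alpha> {1..r}"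
  shows "e \<beta> \<in> root_space H \<beta>" "f \<beta> \<in> root_space H (- \<beta>)" "killing (e \<beta>) (f \<beta>) = 1"
  using root_vectors assms by (auto simp: root_vectors_def)

section \<open>Coroots and the induced form on the dual of the Cartan subalgebra\<close>

text \<open>For a positive root, the normalization of \<open>e \<beta>\<close> and
  \<open>f \<beta>\<close> makes this the element of \<open>H\<close> that represents
  \<open>\<beta>\<close> under the Killing form, rather than the coroot on which
  \<open>\<beta>\<close> takes the value 2.\<close>

definition coroot :: "('g \<Rightarrow> complex) \<Rightarrow> 'g" where "coroot \<beta> = \<^bold>[e \<beta>, f \<beta>\<^bold>]"

lemma coroot:
  assumes "\<beta> \<in> pos_roots H \<alpha> {1..r}"
  shows "coroot \<beta> \<in> H" "\<And>h. h \<in> H \<Longrightarrow> killing (coroot \<beta>) h = \<beta> h"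
proof -
  have ef: "\<^bold>[h, e \<beta>\<^bold>] = \<beta> h *\<^sub>C e \<beta>" "\<^bold>[h, f \<beta>\<^bold>] = - (\<beta> h *\<^sub>C f \<beta>)" if "h \<in> H" for h
    using root_vectorsD[OF assms] that by (simp_all add: root_space_def)
  show "coroot \<beta> \<in> H"
    by (rule H_maximal) (simp add: coroot_def lie_bracket_derivation ef lie_scale_left lie_scale_right
        clinear_uminus[OF clinear_ad(1)])
  show "killing (coroot \<beta>) h = \<beta> h" if "h \<in> H" for h
    using that root_vectorsD(3)[OF assms] lie_antisym[of "f \<beta>" h]
    by (simp add: coroot_def killing_invariant ef clinear_scale[OF clinear_killing_right] scaleC_complex_def)
qed

lemma killing_nondegenerate_on_H:
  assumes "h \<in> H" "h' \<in> H" "\<And>x. x \<in> H \<Longrightarrow> killing h x = killing h' x"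
  shows "h = h'"
proof -
  have H: "h - h' \<in> H" using assms H_subspace by (simp add: complex_vector.subspace_diff)
  have "\<alpha> s (h - h') = 0" if "s \<in> {1..r}" for s
  proof -
    note pos = simple_root_pos[OF subset_refl that]
    have "\<alpha> s (h - h') = killing (h - h') (coroot (\<alpha> s))"
      using coroot(2)[OF pos H] killing_commute by metis
    also have "\<dots> = 0"
      using assms(3)[OF coroot(1)[OF pos]] by (simp add: clinear_diff[OF clinear_killing_left])
    finally show ?thesis .
  qed
  then have "h - h' = 0" by (rule simple_roots_separate[OF H])
  then show ?thesis by simp
qed

lemma simple_roots_dual_basis:
  "\<exists>v. (\<forall>s\<in>{1..r}. v s \<in> H) \<and> (\<forall>s\<in>{1..r}. \<forall>s'\<in>{1..r}. \<alpha> s (v s') = (if s = s' then 1 else 0))"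
proof (rule dual_basis_exists[OF H_subspace finite_atLeastAtMost])
  show "\<alpha> s \<in> dual_on H" if "s \<in> {1..r}" for s using that by (intro root_dual simple_root)
  show "\<forall>s\<in>{1..r}. c s = 0" if "\<And>x. (\<Sum>s\<in>{1..r}. c s * \<alpha> s x) = 0" for c
    using that by (rule simple_roots_independent)
qed

text \<open>With \<open>v\<close> dual to the simple roots, \<open>\<phi>\<close> is the combination
  of the simple roots with coefficients \<open>\<phi> (v s)\<close>; each simple root is represented
  by its coroot.\<close>

lemma killing_represents:
  assumes \<phi>: "\<phi> \<in> dual_on H"
  shows "\<exists>h\<in>H. \<forall>x\<in>H. killing h x = \<phi> x"
proof -
  obtain v where v: "\<And>s. s \<in> {1..r} \<Longrightarrow> v s \<in> H"
    "\<And>s s'. s \<in> {1..r} \<Longrightarrow> s' \<in> {1..r} \<Longrightarrow> \<alpha> s (v s') = (if s = s' then 1 else 0)"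
    using simple_roots_dual_basis by blast
  let ?h = "\<Sum>s\<in>{1..r}. \<phi> (v s) *\<^sub>C coroot (\<alpha> s)"
  note pos = simple_root_pos[OF subset_refl]
  have "?h \<in> H"
    by (intro complex_vector.subspace_sum[OF H_subspace] complex_vector.subspace_scale[OF H_subspace]
        coroot(1) pos)
  moreover have "killing ?h x = \<phi> x" if x: "x \<in> H" for x
  proof -
    let ?w = "\<Sum>s\<in>{1..r}. \<alpha> s x *\<^sub>C v s"
    have mem: "\<alpha> s x *\<^sub>C v s \<in> H" if "s \<in> {1..r}" for s
      using v(1)[OF that] by (rule complex_vector.subspace_scale[OF H_subspace])
    have w: "?w \<in> H" using mem by (rule complex_vector.subspace_sum[OF H_subspace])
    have val: "\<psi> ?w = (\<Sum>s\<in>{1..r}. \<alpha> s x * \<psi> (v s))" if "\<psi> \<in> dual_on H" for \<psi>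
      by (subst dual_on_sum[OF that H_subspace]; simp add: mem dual_on_scale[OF that] v(1))
    \<comment> \<open>Expansion of \<open>x\<close> in the dual vectors: these span \<open>H\<close>
      because the simple roots separate its points.\<close>
    have "x - ?w = 0"
    proof (rule simple_roots_separate[OF complex_vector.subspace_diff[OF H_subspace x w]])
      fix i assume i: "i \<in> {1..r}"
      have "\<alpha> i ?w = (\<Sum>s\<in>{1..r}. \<alpha> s x * \<alpha> i (v s))"
        by (rule val[OF root_dual[OF simple_root[OF i]]])
      also have "\<dots> = (\<Sum>s\<in>{1..r}. if i = s then \<alpha> s x else 0)"
        using v(2)[OF i] by (intro sum.cong) auto
      also have "\<dots> = \<alpha> i x" using i by simp
      finally show "\<alpha> i (x - ?w) = 0"
        using dual_on_diff[OF root_dual[OF simple_root[OF i]] H_subspace x w] by simp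
    qed
    then have "\<phi> x = \<phi> ?w" by simp
    also have "\<dots> = (\<Sum>s\<in>{1..r}. \<phi> (v s) * \<alpha> s x)" unfolding val[OF \<phi>] by (simp add: mult.commute)
    also have "\<dots> = killing ?h x"
      using coroot(2)[OF pos x]
      by (simp add: clinear_sum[OF clinear_killing_left] clinear_scale[OF clinear_killing_left] scaleC_complex_def)
    finally show ?thesis ..
  qed
  ultimately show ?thesis by blast
qed

text \<open>Existence and uniqueness together give the definite description its meaning.\<close>

lemma killing_dual:
  assumes "\<phi> \<in> dual_on H"
  shows "killing_dual H \<phi> \<in> H" "x \<in> H \<Longrightarrow> killing (killing_dual H \<phi>) x = \<phi> x"
proof -
  have "\<exists>!h. h \<in> H \<and> (\<forall>x\<in>H. killing h x = \<phi> x)"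
    using killing_represents[OF assms] killing_nondegenerate_on_H by (auto intro!: ex_ex1I)
  from theI'[OF this] show "killing_dual H \<phi> \<in> H" "x \<in> H \<Longrightarrow> killing (killing_dual H \<phi>) x = \<phi> x"
    unfolding killing_dual_def by blast+
qed

lemma dual_form_eval:
  assumes "\<phi> \<in> dual_on H" "\<psi> \<in> dual_on H"
  shows "dual_form H \<phi> \<psi> = \<psi> (killing_dual H \<phi>)"
  unfolding dual_form_def using assms killing_dual killing_commute by metis

text \<open>Since \<open>coroot \<beta>\<close> represents \<open>\<beta>\<close>, symmetry turns
  the pairing into a value of \<open>\<phi>\<close> on a bracket, which is where the vanishing of
  characters on brackets can enter.\<close>

lemma dual_form_pos_root:
  assumes "\<phi> \<in> dual_on H" "\<beta> \<in> pos_roots H \<alpha> {1..r}"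
  shows "dual_form H \<phi> \<beta> = \<phi> (coroot \<beta>)"
proof -
  have "\<beta> \<in> dual_on H" using assms(2) by (simp add: pos_roots_def root_dual)
  then show ?thesis
    using assms killing_dual coroot dual_form_eval killing_commute by metis
qed

section \<open>Levi subalgebras\<close>

context
  fixes I assumes I: "I \<subseteq> {1..r}"
begin

section \<open>The center of the Levi subalgebra\<close>

lemma pos_roots_levi: "pos_roots H \<alpha> I \<subseteq> pos_roots H \<alpha> {1..r}"
  using I by (rule pos_roots_mono) simp

lemma root_vectors_in_levi:
  assumes "\<beta> \<in> pos_roots H \<alpha> I"
  shows "e \<beta> \<in> levi H \<alpha> I" "f \<beta> \<in> levi H \<alpha> I"
  using assms root_vectorsD[of \<beta>] pos_roots_levi
  unfolding levi_def by (auto intro!: complex_vector.span_base)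

text \<open>Commuting with \<open>H\<close> puts \<open>x\<close> into \<open>H\<close> by
  maximality, and commuting with the nonzero vector \<open>e (\<alpha> i)\<close> forces
  \<open>\<alpha> i x = 0\<close>. Conversely, the roots of the Levi subalgebra are combinations of
  these \<open>\<alpha> i\<close>, so \<open>x\<close> commutes with all generators.\<close>

lemma levi_center_iff: "x \<in> levi_center H \<alpha> I \<longleftrightarrow> x \<in> H \<and> (\<forall>i\<in>I. \<alpha> i x = 0)"
proof
  assume x: "x \<in> levi_center H \<alpha> I"
  then have comm: "\<^bold>[x, y\<^bold>] = 0" if "y \<in> levi H \<alpha> I" for y
    using that by (simp add: levi_center_def)
  have "x \<in> H"
  proof (rule H_maximal)
    fix h assume "h \<in> H"
    then have "\<^bold>[x, h\<^bold>] = 0" unfolding levi_def by (intro comm[unfolded levi_def] complex_vector.span_base) blast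
    then show "\<^bold>[h, x\<^bold>] = 0" using lie_antisym[of h x] by simp
  qed
  moreover have "\<alpha> i x = 0" if i: "i \<in> I" for i
  proof -
    note pos = simple_root_pos[OF I i]
    then have ei: "\<^bold>[x, e (\<alpha> i)\<^bold>] = 0" by (intro comm root_vectors_in_levi)
    have rv: "e (\<alpha> i) \<in> root_space H (\<alpha> i)" "killing (e (\<alpha> i)) (f (\<alpha> i)) = 1"
      using pos pos_roots_levi by (auto intro!: root_vectorsD)
    from rv(1) ei \<open>x \<in> H\<close> have "\<alpha> i x *\<^sub>C e (\<alpha> i) = 0" by (simp add: root_space_def)
    moreover have "e (\<alpha> i) \<noteq> 0" using rv(2) clinear_0[OF clinear_killing_left] by fastforce
    ultimately show ?thesis by simp
  qed
  ultimately show "x \<in> H \<and> (\<forall>i\<in>I. \<alpha> i x = 0)" by blast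
next
  assume x: "x \<in> H \<and> (\<forall>i\<in>I. \<alpha> i x = 0)"
  have "\<^bold>[x, y\<^bold>] = 0" if "y \<in> levi H \<alpha> I" for y
  proof (rule clinear_vanishes_on_span[OF clinear_ad(1) _ that[unfolded levi_def]])
    fix y assume y: "y \<in> H \<union> (\<Union>\<beta>\<in>pos_roots H \<alpha> I. root_space H \<beta> \<union> root_space H (- \<beta>))"
    show "\<^bold>[x, y\<^bold>] = 0"
    proof (cases "y \<in> H")
      case False
      with y obtain \<beta> where \<beta>: "\<beta> \<in> pos_roots H \<alpha> I" "y \<in> root_space H \<beta> \<union> root_space H (- \<beta>)" by blast
      then have "\<beta> x = 0" using x by (auto simp: pos_roots_def nat_combination_def)
      with \<beta>(2) x show ?thesis by (auto simp: root_space_def)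
    qed (use x H_abelian in blast)
  qed
  moreover have "x \<in> levi H \<alpha> I"
    using x unfolding levi_def by (auto intro: complex_vector.span_base)
  ultimately show "x \<in> levi_center H \<alpha> I" by (simp add: levi_center_def)
qed

section \<open>Restrictions of roots to the center and their coefficients\<close>

lemma restrict_center_nat_combination:
  "restrict_center H \<alpha> I (nat_combination \<alpha> {1..r} n) =
    nat_combination (\<lambda>s. restrict_center H \<alpha> I (\<alpha> s)) ({1..r} - I) n"
proof
  fix x
  have "(\<Sum>s\<in>{1..r}. of_nat (n s) * \<alpha> s x) = (\<Sum>s\<in>{1..r} - I. of_nat (n s) * \<alpha> s x)"
    if "x \<in> levi_center H \<alpha> I"
    using that by (intro sum.mono_neutral_right) (auto simp: levi_center_iff)
  then show "restrict_center H \<alpha> I (nat_combination \<alpha> {1..r} n) x =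
    nat_combination (\<lambda>s. restrict_center H \<alpha> I (\<alpha> s)) ({1..r} - I) n x"
    by (simp add: restrict_center_def nat_combination_def)
qed

text \<open>Uniqueness of the coefficients is tested on the vectors dual to the simple roots outside
  \<open>I\<close>: these lie in the center, since every \<open>\<alpha> i\<close> with
  \<open>i \<in> I\<close> vanishes on them, and each one reads off a single coefficient.\<close>

lemma relative_coeffs_nat_combination:
  assumes "s \<in> {1..r} - I"
  shows "relative_coeffs H r \<alpha> I (restrict_center H \<alpha> I (nat_combination \<alpha> {1..r} n)) s = n s"
proof -
  let ?J = "{1..r} - I"
  let ?\<alpha> = "\<lambda>s. restrict_center H \<alpha> I (\<alpha> s)"
  \<comment> \<open>Cut off outside \<open>?J\<close>, because the description in
    \<open>relative_coeffs\<close> singles out the coefficient function that is zero there.\<close>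
  let ?n = "\<lambda>s. if s \<in> ?J then n s else 0"
  obtain v where v: "\<And>s. s \<in> {1..r} \<Longrightarrow> v s \<in> H"
    "\<And>s s'. s \<in> {1..r} \<Longrightarrow> s' \<in> {1..r} \<Longrightarrow> \<alpha> s (v s') = (if s = s' then 1 else 0)"
    using simple_roots_dual_basis by blast
  have eval: "nat_combination ?\<alpha> ?J m (v j) = of_nat (m j)" if "j \<in> ?J" for m j
  proof -
    have "v j \<in> levi_center H \<alpha> I"
      using that v I by (fastforce simp: levi_center_iff)
    then have eq: "nat_combination ?\<alpha> ?J m (v j) = (\<Sum>s\<in>?J. if s = j then of_nat (m s) else 0)"
      unfolding nat_combination_def using that v(2)[of _ j]
      by (intro sum.cong) (auto simp: restrict_center_def)
    with that show ?thesis by (simp del: Diff_iff)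
  qed
  have "relative_coeffs H r \<alpha> I (restrict_center H \<alpha> I (nat_combination \<alpha> {1..r} n)) = ?n"
    unfolding relative_coeffs_def
  proof (rule the_equality)
    show "(\<forall>s. s \<notin> ?J \<longrightarrow> ?n s = 0) \<and>
      restrict_center H \<alpha> I (nat_combination \<alpha> {1..r} n) = nat_combination ?\<alpha> ?J ?n"
      unfolding restrict_center_nat_combination by (simp add: nat_combination_def)
  next
    fix m assume m: "(\<forall>s. s \<notin> ?J \<longrightarrow> m s = 0) \<and>
      restrict_center H \<alpha> I (nat_combination \<alpha> {1..r} n) = nat_combination ?\<alpha> ?J m"
    then have eq: "nat_combination ?\<alpha> ?J m (v j) = nat_combination ?\<alpha> ?J n (v j)" for j
      unfolding restrict_center_nat_combination by simp
    have "m j = n j" if "j \<in> ?J" for j using eq[of j] unfolding eval[OF that] by simp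
    with m show "m = ?n" by auto
  qed
  with assms show ?thesis by simp
qed

section \<open>Characters and the values of torus characters\<close>

text \<open>The coroot of \<open>\<alpha> i\<close> lies in \<open>H\<close> and is a bracket of two
  elements of the Levi subalgebra, exactly where characters vanish.\<close>

lemma levi_character_orthogonal:
  assumes "\<xi> \<in> levi_characters H \<alpha> I" "i \<in> I"
  shows "dual_form H \<xi> (\<alpha> i) = 0"
proof -
  have pos: "\<alpha> i \<in> pos_roots H \<alpha> I" by (rule simple_root_pos[OF I assms(2)])
  then have "coroot (\<alpha> i) \<in> lie_product (levi H \<alpha> I) (levi H \<alpha> I)"
    unfolding coroot_def lie_product_def
    using root_vectors_in_levi by (intro complex_vector.span_base) blast
  with pos pos_roots_levi show ?thesis
    using assms(1) dual_form_pos_root[of \<xi> "\<alpha> i"] coroot(1)[of "\<alpha> i"] by (auto simp: levi_characters_def)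
qed

text \<open>Expanding \<open>\<beta>\<close> in simple roots, the terms from \<open>I\<close> drop
  out by orthogonality. The remaining coefficients are those of the restriction of
  \<open>\<beta>\<close>, and \<open>exp\<close> turns the sum into the product defining the torus
  character.\<close>

lemma torus_character_eq_exp:
  assumes \<xi>: "\<xi> \<in> levi_characters H \<alpha> I"
    and t: "\<forall>s\<in>{1..r} - I. exp (- dual_form H \<xi> (\<alpha> s)) = t s"
    and \<beta>: "\<beta> \<in> pos_roots H \<alpha> {1..r}"
  shows "torus_character H r \<alpha> I (restrict_center H \<alpha> I \<beta>) t = exp (- dual_form H \<xi> \<beta>)"
proof -
  from \<beta> obtain n where n: "\<beta> = nat_combination \<alpha> {1..r} n" and dual: "\<beta> \<in> dual_on H"
    by (auto simp: pos_roots_def root_dual)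
  have \<xi>_dual: "\<xi> \<in> dual_on H" using \<xi> by (simp add: levi_characters_def)
  have "dual_form H \<xi> \<beta> = (\<Sum>s\<in>{1..r}. of_nat (n s) * \<alpha> s (killing_dual H \<xi>))"
    unfolding dual_form_eval[OF \<xi>_dual dual] by (simp add: n nat_combination_def)
  also have "\<dots> = (\<Sum>s\<in>{1..r}. of_nat (n s) * dual_form H \<xi> (\<alpha> s))"
    by (intro sum.cong refl) (simp add: dual_form_eval[OF \<xi>_dual] root_dual simple_root)
  also have "\<dots> = (\<Sum>s\<in>{1..r} - I. of_nat (n s) * dual_form H \<xi> (\<alpha> s))"
    by (intro sum.mono_neutral_right) (auto simp: levi_character_orthogonal[OF \<xi>])
  finally have "exp (- dual_form H \<xi> \<beta>) = (\<Prod>s\<in>{1..r} - I. exp (of_nat (n s) * - dual_form H \<xi> (\<alpha> s)))"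
    by (simp add: sum_negf[symmetric] exp_sum)
  also have "\<dots> = (\<Prod>s\<in>{1..r} - I. t s ^ n s)"
    by (intro prod.cong refl) (metis t exp_of_nat_mult)
  also have "\<dots> = torus_character H r \<alpha> I (restrict_center H \<alpha> I \<beta>) t"
    unfolding torus_character_def n
    by (intro prod.cong refl) (simp only: relative_coeffs_nat_combination)
  finally show ?thesis ..
qed

section \<open>Reduction to sums over the outer roots\<close>

lemma finite_pos_roots: "finite (pos_roots H \<alpha> S)"
  using finite_roots by (rule finite_subset[rotated]) (auto simp: pos_roots_def)

text \<open>For a root of the Levi subalgebra both root vectors lie in that subalgebra, so its wedge
  acts by zero.\<close>

lemma right_action_standard_r:
  assumes g: "g\<^sub>1 \<in> homogeneous_functions (levi H \<alpha> I)" "g\<^sub>2 \<in> homogeneous_functions (levi H \<alpha> I)"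
  shows "right_action (standard_r H r \<alpha> e f) g\<^sub>1 g\<^sub>2 =
    (1/2) *\<^sub>C (\<Sum>\<beta>\<in>outer_roots H r \<alpha> I. right_action (wedge (e \<beta>) (f \<beta>)) g\<^sub>1 g\<^sub>2)"
proof -
  have "(\<Sum>\<beta>\<in>pos_roots H \<alpha> {1..r}. right_action (wedge (e \<beta>) (f \<beta>)) g\<^sub>1 g\<^sub>2) =
    (\<Sum>\<beta>\<in>outer_roots H r \<alpha> I. right_action (wedge (e \<beta>) (f \<beta>)) g\<^sub>1 g\<^sub>2)"
    unfolding outer_roots_def
    by (rule sum.mono_neutral_right)
       (auto simp: finite_pos_roots intro!: right_action_wedge_eq_0[OF g] root_vectors_in_levi)
  then show ?thesis
    by (simp add: standard_r_def clinear_scale[OF clinear_right_action] clinear_sum[OF clinear_right_action])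
qed

text \<open>The outer roots are partitioned by their restriction to the center, so the double sum
  collapses; the factor 1/2 moves into the denominators.\<close>

lemma rho_sum_outer_roots:
  "rho H r \<alpha> I e f t = (\<Sum>\<beta>\<in>outer_roots H r \<alpha> I.
    (let c = torus_character H r \<alpha> I (restrict_center H \<alpha> I \<beta>) t in (1 + c) / (2 * (1 - c))) *\<^sub>C wedge (e \<beta>) (f \<beta>))"
proof -
  have fin: "finite (outer_roots H r \<alpha> I)" by (simp add: outer_roots_def finite_pos_roots)
  show ?thesis
    unfolding rho_def relative_roots_def complex_vector.scale_sum_right
      sum.image_gen[OF fin, of _ "restrict_center H \<alpha> I"]
    by (intro sum.cong refl) (auto simp: scaleC_scaleC Let_def)
qed

end

end

section \<open>Coincidence of the two brackets on functions on the quotient\<close>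

theorem corollary4p12:
  fixes H :: "'g::complex_lie_algebra set"
    and r :: nat and \<alpha> :: "nat \<Rightarrow> 'g \<Rightarrow> complex" and I :: "nat set"
    and e f :: "('g \<Rightarrow> complex) \<Rightarrow> 'g"
    and t :: "nat \<Rightarrow> complex" and \<xi> :: "'g \<Rightarrow> complex"
    and Lstar Hstar :: "(complex^'n^'n) set"
    and \<iota> :: "('g \<Rightarrow> complex) \<Rightarrow> complex^'n^'n"
    and pb :: "(complex^'n^'n \<Rightarrow> complex) \<Rightarrow> (complex^'n^'n \<Rightarrow> complex) \<Rightarrow> complex^'n^'n \<Rightarrow> complex"
    and \<sigma> :: "complex^'n^'n \<Rightarrow> ('g, 'g) tensor"
    and chiL :: "complex^'n^'n"
  assumes simple: "simple_lie_algebra TYPE('g)"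
    and cartan: "cartan_subalgebra H"
    and simple_roots: "simple_roots H r \<alpha>"
    and levi: "I \<subseteq> {1..r}"
    and root_vectors: "root_vectors H r \<alpha> e f"
    and t_nonzero: "\<forall>s\<in>{1..r} - I. t s \<noteq> 0"
    and t_generic: "\<forall>\<theta>\<in>relative_roots H r \<alpha> I. torus_character H r \<alpha> I \<theta> t \<noteq> 1"
    and character: "\<xi> \<in> levi_characters H \<alpha> I"
    and regular: "regular_character H r \<alpha> I \<xi>"
    and t_eq: "\<forall>s\<in>{1..r} - I. exp (- dual_form H \<xi> (\<alpha> s)) = t s"
    and Lstar: "dual_poisson_lie_group (levi H \<alpha> I) (cobracket (standard_r H r \<alpha> e f)) Lstar \<iota> pb"
    and torus: "algebraic_torus Hstar" "Hstar \<subseteq> Lstar"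
      "matrix_lie_algebra Hstar = (\<lambda>\<eta>. \<iota> (cartan_form_extension H \<alpha> I \<eta>)) ` dual_on H"
    and sigma_wedge: "\<forall>A\<in>Lstar. \<sigma> A \<in> wedge_square"
    and sigma_torus: "\<forall>\<eta>\<in>dual_on H. (\<forall>\<beta>\<in>outer_roots H r \<alpha> I. 1 - exp (- dual_form H \<eta> \<beta>) \<noteq> 0) \<longrightarrow>
      \<sigma> (matrix_exp (\<iota> (cartan_form_extension H \<alpha> I \<eta>))) = dynamical_r_on_torus H r \<alpha> I e f \<eta>"
    and point: "chiL = matrix_exp (\<iota> (cartan_form_extension H \<alpha> I \<xi>))"
  shows "\<forall>g\<^sub>1\<in>homogeneous_functions (levi H \<alpha> I). \<forall>g\<^sub>2\<in>homogeneous_functions (levi H \<alpha> I).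
    reduced_bracket (standard_r H r \<alpha> e f) (\<sigma> chiL) g\<^sub>1 g\<^sub>2 =
    rho_bracket (standard_r H r \<alpha> e f) (rho H r \<alpha> I e f t) g\<^sub>1 g\<^sub>2"
proof (intro ballI)
  interpret lie_algebra_with_simple_roots H r \<alpha> e f
    using simple cartan simple_roots root_vectors by unfold_locales
  fix g\<^sub>1 g\<^sub>2
  assume g: "g\<^sub>1 \<in> homogeneous_functions (levi H \<alpha> I)" "g\<^sub>2 \<in> homogeneous_functions (levi H \<alpha> I)"
  let ?R = "\<lambda>\<beta>. right_action (wedge (e \<beta>) (f \<beta>)) g\<^sub>1 g\<^sub>2"
  let ?O = "outer_roots H r \<alpha> I"
  let ?c = "\<lambda>\<beta>. exp (- dual_form H \<xi> \<beta>)"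
  note linear = clinear_sum[OF clinear_right_action] clinear_scale[OF clinear_right_action]
  have chi: "torus_character H r \<alpha> I (restrict_center H \<alpha> I \<beta>) t = ?c \<beta>" if "\<beta> \<in> ?O" for \<beta>
    using that by (intro torus_character_eq_exp[OF levi character t_eq]) (simp add: outer_roots_def)
  \<comment> \<open>Genericity of \<open>t\<close>, carried over by \<open>chi\<close>, gives the
    nonzero denominators under which \<open>sigma_torus\<close> fixes the value of
    \<open>\<sigma>\<close> at \<open>chiL\<close>.\<close>
  have generic: "1 - ?c \<beta> \<noteq> 0" if "\<beta> \<in> ?O" for \<beta>
    using that t_generic chi[OF that] by (auto simp: relative_roots_def)
  then have \<sigma>: "\<sigma> chiL = dynamical_r_on_torus H r \<alpha> I e f \<xi>"
    using sigma_torus character unfolding point by (simp add: levi_characters_def)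
  \<comment> \<open>Both brackets contain the same left action term, so it is enough that the right
    action of \<open>\<sigma> chiL\<close> is the sum of those of \<open>standard_r\<close> and
    \<open>rho\<close>.\<close>
  have "right_action (\<sigma> chiL) g\<^sub>1 g\<^sub>2 = (\<Sum>\<beta>\<in>?O. (1 / (1 - ?c \<beta>)) *\<^sub>C ?R \<beta>)"
    by (simp add: \<sigma> dynamical_r_on_torus_def linear)
  \<comment> \<open>The first summand is the share of \<open>standard_r\<close>, the second that of
    \<open>rho\<close>.\<close>
  also have "\<dots> = (\<Sum>\<beta>\<in>?O. (1/2) *\<^sub>C ?R \<beta> + ((1 + ?c \<beta>) / (2 * (1 - ?c \<beta>))) *\<^sub>C ?R \<beta>)"
  proof (rule sum.cong[OF refl])
    fix \<beta> assume "\<beta> \<in> ?O"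
    then have "1 / (1 - ?c \<beta>) = 1/2 + (1 + ?c \<beta>) / (2 * (1 - ?c \<beta>))"
      using generic[of \<beta>] by (simp add: field_simps)
    then show "(1 / (1 - ?c \<beta>)) *\<^sub>C ?R \<beta> = (1/2) *\<^sub>C ?R \<beta> + ((1 + ?c \<beta>) / (2 * (1 - ?c \<beta>))) *\<^sub>C ?R \<beta>"
      by (simp only: scaleC_add_left)
  qed
  also have "\<dots> = right_action (standard_r H r \<alpha> e f) g\<^sub>1 g\<^sub>2 + right_action (rho H r \<alpha> I e f t) g\<^sub>1 g\<^sub>2"
    unfolding right_action_standard_r[OF levi g] rho_sum_outer_roots[OF levi] linear
      complex_vector.scale_sum_right sum.distrib
    by (simp add: chi Let_def)
  finally show "reduced_bracket (standard_r H r \<alpha> e f) (\<sigma> chiL) g\<^sub>1 g\<^sub>2 =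
      rho_bracket (standard_r H r \<alpha> e f) (rho H r \<alpha> I e f t) g\<^sub>1 g\<^sub>2"
    by (simp add: reduced_bracket_def poisson_lie_bracket_def rho_bracket_def)
qed

end
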